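(* There is a 1-parameter family, with parameter $\alpha\neq0$, of generalised Ricci solitons defining a 1-parameter family of vacuum near-horizon geometries, i.e. of solutions of $\nabla_{(a}X_{b)}+X_aX_b-\tfrac12R_{ab}=0$, given by $$g=\frac{1-z^2}{1+z^2}\,dx^2+\frac{\alpha^2(1+z^2)}{1-z^2}\,dz^2,\qquad X=\frac{1-z^2}{\alpha(1+z^2)^2}\,dx+\frac{z}{1+z^2}\,dz .$$ The extremal horizon lives on a smooth surface of revolution with the topology of a 2-sphere. The surface is parametrised by $(x,z)$ with the ranges $0\le x\le4\alpha\pi$, $-1\le z\le1$. This near-horizon geometry coincides with the Kerr extremal horizon with mass $M=\alpha$. The passage to the standard Kerr coordinates $(\theta,\phi)$ is given by $z=\cos\theta$, $x=2\phi$.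
   Context: $\nabla$ is the Levi-Civita connection of $g$, $R_{ab}$ its Ricci tensor (in dimension 2, $R_{ab}=Kg_{ab}$ with $K$ the Gauss curvature), and round brackets denote symmetrisation (with factor $\tfrac12$). A generalised Ricci soliton is a pair $(g,X)$ with $\nabla_{(a}X_{b)}+c_1X_aX_b-c_2R_{ab}=\lambda g_{ab}$ for real constants $c_1,c_2,\lambda$; the vacuum near-horizon geometry equation considered here is the case $c_1=1$, $c_2=\tfrac12$, $\lambda=0$. The family is the case $\beta=0$, $\gamma=1$ of the 3-parameter family of solutions $g=\frac{2\beta z+\gamma(1-z^2)}{1+z^2}dx^2+\frac{\alpha^2(1+z^2)}{2\beta z+\gamma(1-z^2)}dz^2$, $X=\frac{2\beta z+\gamma(1-z^2)}{\alpha(1+z^2)^2}dx+\frac{z}{1+z^2}dz$. The coordinate $x$ is the azimuthal coordinate along the orbits of the Killing field $\partial_x$.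
   Formalization: With M=α and the standard 2π-periodic φ, x=2φ fails unless |α|=1; the formal version proves x=2αφ, and also x=2φ with φ rescaled to be α times the standard azimuth. For α<0 the (empty) range 0≤x≤4απ is read as the interval between 4απ and 0. *)

theory Defs
  imports "HOL-Analysis.Analysis"
begin

section \<open>Smooth functions and tensor components in coordinates\<close>

definition pd :: "'n::finite \<Rightarrow> (real^'n \<Rightarrow> real) \<Rightarrow> real^'n \<Rightarrow> real"
  where "pd i f p = deriv (\<lambda>t. f (p + t *\<^sub>R axis i 1)) 0"

primrec Ck_on :: "nat \<Rightarrow> (real^'n::finite) set \<Rightarrow> (real^'n \<Rightarrow> real) \<Rightarrow> bool"
  where
    "Ck_on 0 S f \<longleftrightarrow> continuous_on S f"
  | "Ck_on (Suc k) S f \<longleftrightarrow> f differentiable_on S \<and> (\<forall>i. Ck_on k S (pd i f))"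

text \<open>Only used for open sets.\<close>
definition smooth_on :: "(real^'n::finite) set \<Rightarrow> (real^'n \<Rightarrow> real) \<Rightarrow> bool"
  where "smooth_on S f \<longleftrightarrow> (\<forall>k. Ck_on k S f)"

text \<open>Vector fields and one-forms are given by their components, metrics by the
  matrix of their components.\<close>

type_synonym 'n vec_field = "real^'n \<Rightarrow> real^'n"
type_synonym 'n metric_field = "real^'n \<Rightarrow> real^'n^'n"

definition smooth_vec_on :: "(real^'n::finite) set \<Rightarrow> (real^'n \<Rightarrow> real^'m::finite) \<Rightarrow> bool"
  where "smooth_vec_on S X \<longleftrightarrow> (\<forall>i. smooth_on S (\<lambda>p. X p $ i))"

definition smooth_mat_on :: "(real^'n::finite) set \<Rightarrow> 'n metric_field \<Rightarrow> bool"
  where "smooth_mat_on S g \<longleftrightarrow> (\<forall>i j. smooth_on S (\<lambda>p. g p $ i $ j))"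

definition riemannian_on :: "(real^'n::finite) set \<Rightarrow> 'n metric_field \<Rightarrow> bool"
  where "riemannian_on S g \<longleftrightarrow> smooth_mat_on S g \<and>
    (\<forall>p\<in>S. transpose (g p) = g p \<and> (\<forall>u. u \<noteq> 0 \<longrightarrow> u \<bullet> (g p *v u) > 0))"

definition pseudo_riemannian_on :: "(real^'n::finite) set \<Rightarrow> 'n metric_field \<Rightarrow> bool"
  where "pseudo_riemannian_on S g \<longleftrightarrow> smooth_mat_on S g \<and>
    (\<forall>p\<in>S. transpose (g p) = g p \<and> invertible (g p))"


section \<open>Levi-Civita connection and Ricci tensor\<close>

text \<open>\<open>christoffel g k i j\<close> is \<open>\<Gamma>\<^sup>k\<^sub>i\<^sub>j\<close>.\<close>
definition christoffel :: "'n::finite metric_field \<Rightarrow> 'n \<Rightarrow> 'n \<Rightarrow> 'n \<Rightarrow> real^'n \<Rightarrow> real"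
  where "christoffel g k i j p =
    (\<Sum>l\<in>UNIV. matrix_inv (g p) $ k $ l *
       (pd i (\<lambda>q. g q $ l $ j) p + pd j (\<lambda>q. g q $ i $ l) p - pd l (\<lambda>q. g q $ i $ j) p)) / 2"

text \<open>Signed so that round spheres have positive Ricci curvature; in dimension 2,
  \<open>R\<^sub>a\<^sub>b = K g\<^sub>a\<^sub>b\<close>.\<close>
definition ricci :: "'n::finite metric_field \<Rightarrow> 'n \<Rightarrow> 'n \<Rightarrow> real^'n \<Rightarrow> real"
  where "ricci g i j p =
    (\<Sum>k\<in>UNIV. pd k (christoffel g k i j) p - pd j (christoffel g k i k) p +
      (\<Sum>l\<in>UNIV. christoffel g k k l p * christoffel g l i j p
               - christoffel g k j l p * christoffel g l i k p))"

text \<open>\<open>\<nabla>\<^sub>a X\<^sub>b\<close> for a one-form and \<open>\<nabla>\<^sub>a K\<^sup>b\<close> for a vector field.\<close>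
definition nabla_form :: "'n::finite metric_field \<Rightarrow> 'n vec_field \<Rightarrow> 'n \<Rightarrow> 'n \<Rightarrow> real^'n \<Rightarrow> real"
  where "nabla_form g X a b p =
    pd a (\<lambda>q. X q $ b) p - (\<Sum>c\<in>UNIV. christoffel g c a b p * X p $ c)"

definition nabla_vec :: "'n::finite metric_field \<Rightarrow> 'n vec_field \<Rightarrow> 'n \<Rightarrow> 'n \<Rightarrow> real^'n \<Rightarrow> real"
  where "nabla_vec g K a b p =
    pd a (\<lambda>q. K q $ b) p + (\<Sum>c\<in>UNIV. christoffel g b a c p * K p $ c)"

definition cov_deriv :: "'n::finite metric_field \<Rightarrow> 'n vec_field \<Rightarrow> real^'n \<Rightarrow> real^'n \<Rightarrow> real^'n"
  where "cov_deriv g K u p = (\<chi> b. \<Sum>a\<in>UNIV. u $ a * nabla_vec g K a b p)"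

definition killing_at :: "'n::finite metric_field \<Rightarrow> 'n vec_field \<Rightarrow> real^'n \<Rightarrow> bool"
  where "killing_at g K p \<longleftrightarrow> (\<forall>a b.
    (\<Sum>c\<in>UNIV. K p $ c * pd c (\<lambda>q. g q $ a $ b) p + g p $ c $ b * pd a (\<lambda>q. K q $ c) p
              + g p $ a $ c * pd b (\<lambda>q. K q $ c) p) = 0)"

text \<open>\<open>jac \<psi> q i\<close> is the coordinate tangent vector \<open>\<partial>\<^sub>i \<psi>\<close>.\<close>
definition jac :: "(real^'n::finite \<Rightarrow> real^'m::finite) \<Rightarrow> real^'n \<Rightarrow> 'n \<Rightarrow> real^'m"
  where "jac \<psi> q i = (\<chi> a. pd i (\<lambda>r. \<psi> r $ a) q)"

definition pull_metric ::
  "(real^'n::finite \<Rightarrow> real^'m::finite) \<Rightarrow> 'm metric_field \<Rightarrow> 'n metric_field"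
  where "pull_metric \<psi> G q = (\<chi> i j. jac \<psi> q i \<bullet> (G (\<psi> q) *v jac \<psi> q j))"

definition pull_form ::
  "(real^'n::finite \<Rightarrow> real^'m::finite) \<Rightarrow> 'm vec_field \<Rightarrow> 'n vec_field"
  where "pull_form \<psi> W q = (\<chi> i. W (\<psi> q) \<bullet> jac \<psi> q i)"


section \<open>Generalised Ricci solitons and near-horizon geometries\<close>

definition generalised_ricci_soliton_at ::
  "real \<Rightarrow> real \<Rightarrow> real \<Rightarrow> 'n::finite metric_field \<Rightarrow> 'n vec_field \<Rightarrow> real^'n \<Rightarrow> bool"
  where "generalised_ricci_soliton_at c1 c2 lam g X p \<longleftrightarrow> (\<forall>a b.
    (nabla_form g X a b p + nabla_form g X b a p) / 2 + c1 * (X p $ a * X p $ b)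
      - c2 * ricci g a b p = lam * g p $ a $ b)"

definition generalised_ricci_soliton_on ::
  "(real^'n::finite) set \<Rightarrow> real \<Rightarrow> real \<Rightarrow> real \<Rightarrow> 'n metric_field \<Rightarrow> 'n vec_field \<Rightarrow> bool"
  where "generalised_ricci_soliton_on D c1 c2 lam g X \<longleftrightarrow>
    open D \<and> riemannian_on D g \<and> smooth_vec_on D X \<and>
    (\<forall>p\<in>D. generalised_ricci_soliton_at c1 c2 lam g X p)"

abbreviation vacuum_near_horizon_at :: "'n::finite metric_field \<Rightarrow> 'n vec_field \<Rightarrow> real^'n \<Rightarrow> bool"
  where "vacuum_near_horizon_at \<equiv> generalised_ricci_soliton_at 1 (1/2) 0"

abbreviation vacuum_near_horizon_on ::
  "(real^'n::finite) set \<Rightarrow> 'n metric_field \<Rightarrow> 'n vec_field \<Rightarrow> bool"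
  where "vacuum_near_horizon_on D \<equiv> generalised_ricci_soliton_on D 1 (1/2) 0"


section \<open>Geometry on the 2-sphere\<close>

text \<open>The smooth 2-sphere is the unit sphere of \<open>\<real>\<^sup>3\<close>. A tensor on it is represented by an
  ambient tensor, of which only the restriction to tangent vectors of the sphere matters;
  smooth tensors on the sphere are exactly the restrictions of smooth ambient ones.\<close>

abbreviation S2 :: "(real^3) set"
  where "S2 \<equiv> sphere 0 1"

definition tangent_S2 :: "real^3 \<Rightarrow> (real^3) set"
  where "tangent_S2 p = {u. u \<bullet> p = 0}"

definition riemannian_S2 :: "3 metric_field \<Rightarrow> bool"
  where "riemannian_S2 G \<longleftrightarrow>
    (\<exists>U. open U \<and> S2 \<subseteq> U \<and> smooth_mat_on U G) \<and>
    (\<forall>p\<in>S2. \<forall>u\<in>tangent_S2 p.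
       (\<forall>v\<in>tangent_S2 p. u \<bullet> (G p *v v) = v \<bullet> (G p *v u)) \<and>
       (u \<noteq> 0 \<longrightarrow> u \<bullet> (G p *v u) > 0))"

definition smooth_form_S2 :: "3 vec_field \<Rightarrow> bool"
  where "smooth_form_S2 W \<longleftrightarrow> (\<exists>U. open U \<and> S2 \<subseteq> U \<and> smooth_vec_on U W)"

definition local_param_S2 :: "(real^2) set \<Rightarrow> (real^2 \<Rightarrow> real^3) \<Rightarrow> bool"
  where "local_param_S2 U \<psi> \<longleftrightarrow> open U \<and> smooth_vec_on U \<psi> \<and> \<psi> ` U \<subseteq> S2 \<and> inj_on \<psi> U \<and>
    (\<forall>q\<in>U. \<forall>c :: real^2. (\<Sum>i\<in>UNIV. c $ i *\<^sub>R jac \<psi> q i) = 0 \<longrightarrow> c = 0)"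

text \<open>The equation is tensorial, so at each point of the sphere it may be tested in any one
  local parametrisation around that point.\<close>
definition vacuum_near_horizon_S2 :: "3 metric_field \<Rightarrow> 3 vec_field \<Rightarrow> bool"
  where "vacuum_near_horizon_S2 G W \<longleftrightarrow> riemannian_S2 G \<and> smooth_form_S2 W \<and>
    (\<forall>p\<in>S2. \<exists>U \<psi>. local_param_S2 U \<psi> \<and>
       (\<exists>q\<in>U. \<psi> q = p \<and> vacuum_near_horizon_at (pull_metric \<psi> G) (pull_form \<psi> W) q))"

definition rot :: "real \<Rightarrow> real^3^3"
  where "rot t = vector [vector [cos t, - sin t, 0], vector [sin t, cos t, 0], vector [0, 0, 1]]"

text \<open>A surface of revolution in the intrinsic sense. It need not embed isometrically in
  \<open>\<real>\<^sup>3\<close>; the extremal Kerr horizon, having negative curvature at its poles, does not embed as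
  a rotationally symmetric surface there.\<close>
definition rotation_invariant_S2 :: "3 metric_field \<Rightarrow> 3 vec_field \<Rightarrow> bool"
  where "rotation_invariant_S2 G W \<longleftrightarrow>
    (\<forall>t. \<forall>p\<in>S2. \<forall>u\<in>tangent_S2 p.
       W (rot t *v p) \<bullet> (rot t *v u) = W p \<bullet> u \<and>
       (\<forall>v\<in>tangent_S2 p.
          (rot t *v u) \<bullet> (G (rot t *v p) *v (rot t *v v)) = u \<bullet> (G p *v v)))"


section \<open>The family\<close>

text \<open>Coordinates \<open>(x, z)\<close> are components 1 and 2.\<close>

definition xz_domain :: "(real^2) set"
  where "xz_domain = {p. -1 < p $ 2 \<and> p $ 2 < 1}"

definition g_fam :: "real \<Rightarrow> 2 metric_field"
  where "g_fam \<alpha> p = (let z = p $ 2 in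
    vector [vector [(1 - z^2) / (1 + z^2), 0],
            vector [0, \<alpha>^2 * (1 + z^2) / (1 - z^2)]])"

definition X_fam :: "real \<Rightarrow> 2 vec_field"
  where "X_fam \<alpha> p = (let z = p $ 2 in
    vector [(1 - z^2) / (\<alpha> * (1 + z^2)^2), z / (1 + z^2)])"

text \<open>For \<open>\<alpha> > 0\<close> this is \<open>0 \<le> x \<le> 4\<alpha>\<pi>\<close>, \<open>-1 \<le> z \<le> 1\<close>; for \<open>\<alpha> < 0\<close> the interval of \<open>x\<close> is
  traversed from \<open>0\<close> down to \<open>4\<alpha>\<pi>\<close>.\<close>
definition xz_rectangle :: "real \<Rightarrow> (real^2) set"
  where "xz_rectangle \<alpha> = {p. p $ 1 \<in> closed_segment 0 (4 * \<alpha> * pi) \<and> p $ 2 \<in> {-1..1}}"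

definition sphere_param :: "real \<Rightarrow> real^2 \<Rightarrow> real^3"
  where "sphere_param \<alpha> p = (let x = p $ 1; z = p $ 2 in
    vector [sqrt (1 - z^2) * cos (x / (2 * \<alpha>)), sqrt (1 - z^2) * sin (x / (2 * \<alpha>)), z])"

text \<open>The sides \<open>x = 0\<close> and \<open>x = 4\<alpha>\<pi>\<close> are identified and each of the sides \<open>z = 1\<close>,
  \<open>z = -1\<close> is collapsed to a pole.\<close>
definition sphere_glue :: "real \<Rightarrow> real^2 \<Rightarrow> real^2 \<Rightarrow> bool"
  where "sphere_glue \<alpha> p q \<longleftrightarrow> p $ 2 = q $ 2 \<and>
    (p $ 2 = 1 \<or> p $ 2 = -1 \<or> p $ 1 = q $ 1 \<or> {p $ 1, q $ 1} = {0, 4 * \<alpha> * pi})"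


section \<open>The extremal Kerr horizon\<close>

text \<open>A degenerate Killing horizon of a metric \<open>G\<close>, described by a cross-section
  \<open>\<iota> : D \<rightarrow> spacetime\<close>: the Killing field \<open>K\<close> is null on and orthogonal to the cross-section
  and has zero surface gravity, \<open>\<nabla>\<^sub>K K = 0\<close>. Its geometry consists of the induced metric
  \<open>\<gamma>\<close> and the rotation one-form \<open>\<omega>\<close>, \<open>\<nabla>\<^sub>v K = \<omega>(v) K\<close> for \<open>v\<close> tangent to the horizon. In
  Gaussian null coordinates, \<open>ds\<^sup>2 = 2 dv (dr + r h + r\<^sup>2 F dv / 2) + \<gamma>\<close>, one has \<open>\<omega> = -h/2\<close>,
  and the vacuum equation \<open>Ric = h h / 2 - \<nabla>h\<close> becomes the equation above for
  \<open>(g, X) = (\<gamma>, \<omega>)\<close>.\<close>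
definition degenerate_killing_horizon ::
  "'m::finite metric_field \<Rightarrow> 'm vec_field \<Rightarrow> (real^'n::finite) set \<Rightarrow> (real^'n \<Rightarrow> real^'m)
    \<Rightarrow> 'n metric_field \<Rightarrow> 'n vec_field \<Rightarrow> bool"
  where "degenerate_killing_horizon G K D \<iota> \<gamma> \<omega> \<longleftrightarrow>
    (\<exists>N. open N \<and> \<iota> ` D \<subseteq> N \<and> pseudo_riemannian_on N G \<and> smooth_vec_on N K \<and>
         (\<forall>p\<in>N. killing_at G K p)) \<and>
    (\<forall>q\<in>D.
       K (\<iota> q) \<noteq> 0 \<and>
       K (\<iota> q) \<bullet> (G (\<iota> q) *v K (\<iota> q)) = 0 \<and>
       (\<forall>i. K (\<iota> q) \<bullet> (G (\<iota> q) *v jac \<iota> q i) = 0) \<and>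
       cov_deriv G K (K (\<iota> q)) (\<iota> q) = 0 \<and>
       pull_metric \<iota> G q = \<gamma> q \<and>
       (\<forall>i. cov_deriv G K (jac \<iota> q i) (\<iota> q) = \<omega> q $ i *\<^sub>R K (\<iota> q)))"

text \<open>The Kerr metric of mass \<open>M\<close> and rotation parameter \<open>a\<close> in ingoing Kerr coordinates
  \<open>(v, r, \<theta>, \<phi>)\<close>, which are regular across the future horizon.\<close>
definition kerr_metric :: "real \<Rightarrow> real \<Rightarrow> 4 metric_field"
  where "kerr_metric M a p = (let r = p $ 2; s = (sin (p $ 3))^2;
      \<Sigma> = r^2 + a^2 * (cos (p $ 3))^2; \<Delta> = r^2 - 2 * M * r + a^2;
      vp = - (2 * M * a * r * s / \<Sigma>) in
    vector [vector [- (1 - 2 * M * r / \<Sigma>), 1, 0, vp],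
            vector [1, 0, 0, - (a * s)],
            vector [0, 0, \<Sigma>, 0],
            vector [vp, - (a * s), 0, ((r^2 + a^2)^2 - \<Delta> * a^2 * s) * s / \<Sigma>]])"

text \<open>Extremality is \<open>\<bar>a\<bar> = \<bar>M\<bar>\<close>, i.e. \<open>\<Delta> = (r - M)\<^sup>2\<close>, with horizon \<open>r = M\<close> and horizon
  generator \<open>\<partial>\<^sub>v + \<Omega> \<partial>\<^sub>\<phi>\<close>. The two signs of \<open>a\<close> are interchanged by \<open>\<phi> \<mapsto> -\<phi>\<close>.\<close>
definition kerr_horizon_generator :: "real \<Rightarrow> real \<Rightarrow> 4 vec_field"
  where "kerr_horizon_generator M a p = vector [1, 0, 0, a / (M^2 + a^2)]"

text \<open>The cross-section \<open>v = v\<^sub>0\<close> with coordinates \<open>(\<theta>, \<phi>)\<close> as components 1 and 2. With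
  \<open>k = 1\<close>, \<open>\<phi>\<close> is the usual azimuth of period \<open>2\<pi>\<close>; in general \<open>\<phi>\<close> is \<open>k\<close> times it.\<close>
definition kerr_section :: "real \<Rightarrow> real \<Rightarrow> real \<Rightarrow> real^2 \<Rightarrow> real^4"
  where "kerr_section M v0 k q = vector [v0, M, q $ 1, q $ 2 / k]"

definition polar_domain :: "(real^2) set"
  where "polar_domain = {q. 0 < q $ 1 \<and> q $ 1 < pi}"

definition is_extremal_kerr_horizon ::
  "real \<Rightarrow> real \<Rightarrow> real \<Rightarrow> 2 metric_field \<Rightarrow> 2 vec_field \<Rightarrow> bool"
  where "is_extremal_kerr_horizon M a k \<gamma> \<omega> \<longleftrightarrow> a^2 = M^2 \<and>
    (\<forall>v0. degenerate_killing_horizon (kerr_metric M a) (kerr_horizon_generator M a)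
            polar_domain (kerr_section M v0 k) \<gamma> \<omega>)"

text \<open>The coordinate change \<open>z = cos \<theta>\<close>, \<open>x = m \<phi>\<close>.\<close>
definition polar_to_xz :: "real \<Rightarrow> real^2 \<Rightarrow> real^2"
  where "polar_to_xz m q = vector [m * q $ 2, cos (q $ 1)]"

definition polar_rectangle :: "real \<Rightarrow> (real^2) set"
  where "polar_rectangle k = {q. q $ 1 \<in> {0..pi} \<and> q $ 2 \<in> closed_segment 0 (2 * pi * k)}"

end

theory Submission
  imports Defs
begin

text \<open>
  Let \<open>f(z) = (1 - z\<^sup>2) / (1 + z\<^sup>2)\<close>. On the coordinate strip the metric is
  \<open>f dx\<^sup>2 + \<alpha>\<^sup>2 dz\<^sup>2 / f\<close>, whose Ricci tensor is \<open>- f'' / (2 \<alpha>\<^sup>2)\<close> times the metric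
  (\<open>ricci_profile\<close>). The near-horizon equation becomes three identities between rational functions
  of \<open>z\<close> (\<open>vacuum_near_horizon_fam\<close>).

  The coordinate expressions degenerate at \<open>z = 1\<close> and \<open>z = -1\<close>. That the geometry is
  nevertheless smooth at the poles becomes evident from an ambient form. With height \<open>Z = z\<close> and
  azimuth \<open>x / (2 \<alpha>)\<close> on the unit sphere, the pair \<open>(g, X)\<close> is the restriction of
  \<open>\<alpha>\<^sup>2 / (1 + Z\<^sup>2) (4 dX\<^sup>2 + 4 dY\<^sup>2 + (1 - Z\<^sup>2) dZ\<^sup>2)\<close> and
  \<open>2 (X dY - Y dX) / (1 + Z\<^sup>2)\<^sup>2 + Z dZ / (1 + Z\<^sup>2)\<close> (\<open>pull_sphere_param\<close>), which are smooth,
  invariant under rotations about the \<open>Z\<close>-axis, and positive definite on tangent planes. The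
  equation on the strip is the equation on the sphere without its poles. At a pole, in the chart given
  by orthogonal projection, all first derivatives of the metric vanish, so the Ricci tensor can be
  read off the second derivatives (\<open>christoffel_critical\<close>, \<open>vacuum_near_horizon_pole\<close>).

  For the comparison with Kerr, let \<open>k\<close> be the horizon generator \<open>K\<close> with its index lowered. As
  \<open>K\<close> is Killing, its covariant derivative is half the exterior derivative of \<open>k\<close>
  (\<open>cov_deriv_constant_killing\<close>). Along the extremal horizon \<open>r = M\<close> one finds
  \<open>k = (1 - sin\<^sup>2 \<theta> / 2) dr\<close>, and from the first derivatives of \<open>k\<close> both the vanishing of the
  surface gravity and the rotation form
  \<open>- sin \<theta> cos \<theta> / (1 + cos\<^sup>2 \<theta>) d\<theta> - 2 a sin\<^sup>2 \<theta> / (M (1 + cos\<^sup>2 \<theta>)\<^sup>2) d\<phi>\<close>.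
  For \<open>M = \<alpha>\<close> and \<open>a = - \<alpha>\<close> this is \<open>X\<close> under \<open>z = cos \<theta>\<close>, \<open>x = 2 \<alpha> \<phi>\<close>
  (\<open>cov_deriv_generator\<close>, \<open>extremal_kerr_horizon\<close>).
\<close>

section \<open>Partial derivatives and smooth functions\<close>

lemma pd_eqI:
  assumes "((\<lambda>t. f (p + t *\<^sub>R axis i 1)) has_real_derivative D) (at 0)"
  shows "pd i f p = D"
  using assms unfolding pd_def by (rule DERIV_imp_deriv)

lemma has_derivative_imp_DERIV_axis:
  fixes f :: "real^'n::finite \<Rightarrow> real"
  assumes "(f has_derivative f') (at p)"
  shows "((\<lambda>t. f (p + t *\<^sub>R axis i 1)) has_real_derivative f' (axis i 1)) (at 0)"
proof -
  have "((\<lambda>t. p + t *\<^sub>R axis i 1) has_derivative (\<lambda>t. t *\<^sub>R axis i 1)) (at 0)"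
    by (auto intro!: derivative_eq_intros)
  moreover have "(f has_derivative f') (at (p + 0 *\<^sub>R axis i 1))"
    using assms by simp
  ultimately have "((\<lambda>t. f (p + t *\<^sub>R axis i 1)) has_derivative (\<lambda>t. f' (t *\<^sub>R axis i 1))) (at 0)"
    using has_derivative_compose[of "\<lambda>t. p + t *\<^sub>R axis i 1" _ 0 UNIV f f'] by (simp add: o_def)
  moreover have "f' (t *\<^sub>R axis i 1) = t * f' (axis i 1)" for t
    using linear_scale[OF has_derivative_linear[OF assms], of t "axis i 1"] by simp
  ultimately show ?thesis
    by (simp add: has_field_derivative_def mult_commute_abs)
qed

lemma pd_has_derivative:
  assumes "(f has_derivative f') (at p)"
  shows "pd i f p = f' (axis i 1)"
  by (rule pd_eqI[OF has_derivative_imp_DERIV_axis[OF assms]])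

lemma pd_cong_eventually:
  assumes "\<forall>\<^sub>F q in nhds p. f q = g q"
  shows "pd i f p = pd i g p"
proof -
  have "((\<lambda>t. p + t *\<^sub>R axis i 1) \<longlongrightarrow> p + 0 *\<^sub>R axis i 1) (nhds (0::real))"
    by (intro tendsto_intros filterlim_ident)
  hence "filterlim (\<lambda>t. p + t *\<^sub>R axis i 1) (nhds p) (nhds (0::real))" by simp
  hence "\<forall>\<^sub>F t in nhds 0. f (p + t *\<^sub>R axis i 1) = g (p + t *\<^sub>R axis i 1)"
    using assms unfolding filterlim_iff by blast
  thus ?thesis unfolding pd_def by (rule deriv_cong_ev) simp
qed

lemma pd_cong:
  assumes "open S" "p \<in> S" "\<And>q. q \<in> S \<Longrightarrow> f q = g q"
  shows "pd i f p = pd i g p"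
  by (rule pd_cong_eventually) (use assms eventually_nhds in blast)

lemma pd_const [simp]: "pd i (\<lambda>_. c) p = 0"
  by (rule pd_eqI) (auto intro!: derivative_eq_intros)

lemma pd_component: "pd i (\<lambda>q. q $ j) p = (if i = j then 1 else 0)"
  by (rule pd_eqI) (auto intro!: derivative_eq_intros simp: axis_def)

lemma differentiable_on_openD:
  "f differentiable_on S \<Longrightarrow> open S \<Longrightarrow> p \<in> S \<Longrightarrow> f differentiable (at p)"
  by (simp add: differentiable_on_eq_differentiable_at)

lemma pd_add:
  assumes "f differentiable (at p)" "g differentiable (at p)"
  shows "pd i (\<lambda>q. f q + g q) p = pd i f p + pd i g p"
proof -
  obtain f' g' where "(f has_derivative f') (at p)" "(g has_derivative g') (at p)"
    using assms unfolding differentiable_def by blast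
  thus ?thesis
    using pd_has_derivative[OF has_derivative_add, of f f' p g g' i] by (simp add: pd_has_derivative)
qed

lemma pd_mult:
  assumes "f differentiable (at p)" "g differentiable (at p)"
  shows "pd i (\<lambda>q. f q * g q) p = f p * pd i g p + pd i f p * g p"
proof -
  obtain f' g' where "(f has_derivative f') (at p)" "(g has_derivative g') (at p)"
    using assms unfolding differentiable_def by blast
  thus ?thesis
    using pd_has_derivative[OF has_derivative_mult, of f f' p g g' i] by (simp add: pd_has_derivative)
qed

lemma pd_compose:
  assumes "f differentiable (at p)" "(h has_real_derivative D) (at (f p))"
  shows "pd i (\<lambda>q. h (f q)) p = D * pd i f p"
proof -
  obtain f' where f': "(f has_derivative f') (at p)"
    using assms unfolding differentiable_def by blast
  have "((\<lambda>q. h (f q)) has_derivative (\<lambda>v. f' v * D)) (at p)"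
    using has_derivative_compose[OF f' , of h "\<lambda>y. y * D"] assms(2)
    by (simp add: has_field_derivative_def mult_commute_abs)
  thus ?thesis using f' by (simp add: pd_has_derivative)
qed

text \<open>The product and chain rules give the partial derivatives only at points of \<open>S\<close>, whereas
  \<^const>\<open>Ck_on\<close> is about the function \<open>pd i f\<close> itself. On an open set the difference is harmless,
  because a partial derivative depends on the germ of the function only.\<close>
lemma Ck_on_cong:
  assumes "open S" "\<And>p. p \<in> S \<Longrightarrow> f p = g p"
  shows "Ck_on k S f \<longleftrightarrow> Ck_on k S g"
  using assms(2)
proof (induction k arbitrary: f g)
  case 0
  thus ?case by (auto cong: continuous_on_cong)
next
  case (Suc k)
  have "f differentiable_on S \<longleftrightarrow> g differentiable_on S"
    unfolding differentiable_on_def differentiable_def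
    by (metis Suc.prems has_derivative_transform)
  moreover have "Ck_on k S (pd i f) \<longleftrightarrow> Ck_on k S (pd i g)" for i
    by (rule Suc.IH) (use pd_cong[OF assms(1)] Suc.prems in blast)
  ultimately show ?case by simp
qed

lemma Ck_on_Suc_D: "Ck_on (Suc k) S f \<Longrightarrow> Ck_on k S f"
  by (induction k arbitrary: f) (auto intro: differentiable_imp_continuous_on)

lemma Ck_on_const: "Ck_on k S (\<lambda>_. c)"
proof (induction k arbitrary: c)
  case (Suc k)
  have "pd i (\<lambda>_. c) = (\<lambda>_::real^'a. 0)" for i by (rule ext) simp
  thus ?case using Suc by simp
qed simp

lemma Ck_on_component: "Ck_on k S (\<lambda>p. p $ j)"
proof (cases k)
  case 0
  thus ?thesis by (simp add: continuous_on_component continuous_on_id)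
next
  case (Suc k)
  have "pd i (\<lambda>p. p $ j) = (\<lambda>_::real^'a. if i = j then 1 else 0)" for i
    by (rule ext) (simp add: pd_component)
  moreover have "(\<lambda>p::real^'a. p $ j) differentiable_on S"
    by (simp add: bounded_linear_vec_nth bounded_linear_imp_differentiable_on)
  ultimately show ?thesis unfolding Suc by (simp add: Ck_on_const)
qed

lemma Ck_on_add:
  assumes "open S"
  shows "Ck_on k S f \<Longrightarrow> Ck_on k S g \<Longrightarrow> Ck_on k S (\<lambda>p. f p + g p)"
proof (induction k arbitrary: f g)
  case (Suc k)
  have "Ck_on k S (pd i (\<lambda>p. f p + g p)) \<longleftrightarrow> Ck_on k S (\<lambda>p. pd i f p + pd i g p)" for i
    by (rule Ck_on_cong[OF assms], rule pd_add)
       (use Suc.prems differentiable_on_openD assms in auto)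
  thus ?case using Suc by auto
qed (auto intro: continuous_intros)

lemma Ck_on_mult:
  assumes "open S"
  shows "Ck_on k S f \<Longrightarrow> Ck_on k S g \<Longrightarrow> Ck_on k S (\<lambda>p. f p * g p)"
proof (induction k arbitrary: f g)
  case (Suc k)
  have "Ck_on k S (pd i (\<lambda>p. f p * g p)) \<longleftrightarrow> Ck_on k S (\<lambda>p. f p * pd i g p + pd i f p * g p)" for i
    by (rule Ck_on_cong[OF assms], rule pd_mult)
       (use Suc.prems differentiable_on_openD assms in auto)
  moreover have "Ck_on k S f" "Ck_on k S g"
    using Suc.prems Ck_on_Suc_D by blast+
  ultimately show ?case using Suc by (auto intro!: Ck_on_add assms)
qed (auto intro: continuous_intros)

text \<open>The chain rule in the form of an induction step. The derivatives of inverse, square root, sine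
  and cosine are expressions in these functions themselves, so that the last premise becomes the
  induction hypothesis for each of them.\<close>
lemma Ck_on_compose_Suc:
  assumes "open S" "Ck_on (Suc k) S f"
    and h: "\<And>p. p \<in> S \<Longrightarrow> (h has_real_derivative h' (f p)) (at (f p))"
    and h': "Ck_on k S (\<lambda>p. h' (f p))"
  shows "Ck_on (Suc k) S (\<lambda>p. h (f p))"
proof -
  have d: "f differentiable (at p)" if "p \<in> S" for p
    using assms that differentiable_on_openD by auto
  have "Ck_on k S (pd i (\<lambda>p. h (f p))) \<longleftrightarrow> Ck_on k S (\<lambda>p. h' (f p) * pd i f p)" for i
    by (rule Ck_on_cong[OF assms(1)], rule pd_compose) (use d h in auto)
  moreover have "Ck_on k S (\<lambda>p. h' (f p) * pd i f p)" for i
    using assms by (intro Ck_on_mult) auto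
  moreover have "(\<lambda>p. h (f p)) differentiable (at p)" if "p \<in> S" for p
    using differentiable_compose[of h f p UNIV] d[OF that] h[OF that]
    by (metis differentiable_chain_at differentiable_def has_field_derivative_imp_has_derivative o_def
        field_differentiable_imp_differentiable field_differentiable_def)
  ultimately show ?thesis
    using assms(1) by (simp add: differentiable_on_eq_differentiable_at)
qed

lemma Ck_on_inverse:
  assumes "open S" "\<And>p. p \<in> S \<Longrightarrow> f p \<noteq> 0"
  shows "Ck_on k S f \<Longrightarrow> Ck_on k S (\<lambda>p. inverse (f p))"
proof (induction k)
  case 0
  thus ?case using assms by (auto intro: continuous_intros)
next
  case (Suc k)
  have "Ck_on k S (\<lambda>p. (-1) * (inverse (f p) * inverse (f p)))"
    using Suc Ck_on_Suc_D by (intro Ck_on_mult Ck_on_const assms(1)) blast+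
  with Suc.prems show ?case
    by (intro Ck_on_compose_Suc[where h = inverse and h' = "\<lambda>y. (-1) * (inverse y * inverse y)"] assms(1))
       (auto intro!: derivative_eq_intros simp: assms(2))
qed

lemma Ck_on_sqrt:
  assumes "open S" "\<And>p. p \<in> S \<Longrightarrow> f p > 0"
  shows "Ck_on k S f \<Longrightarrow> Ck_on k S (\<lambda>p. sqrt (f p))"
proof (induction k)
  case 0
  thus ?case by (auto intro: continuous_intros)
next
  case (Suc k)
  have "Ck_on k S (\<lambda>p. (1/2) * inverse (sqrt (f p)))"
    using Suc Ck_on_Suc_D
    by (intro Ck_on_mult Ck_on_inverse Ck_on_const assms(1)) (use assms(2) in fastforce)+
  with Suc.prems show ?case
    by (intro Ck_on_compose_Suc[where h = sqrt and h' = "\<lambda>y. (1/2) * inverse (sqrt y)"] assms(1))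
       (use assms(2) in \<open>fastforce intro!: derivative_eq_intros simp: divide_simps\<close>)+
qed

lemma Ck_on_sin_cos:
  assumes "open S"
  shows "Ck_on k S f \<Longrightarrow> Ck_on k S (\<lambda>p. sin (f p)) \<and> Ck_on k S (\<lambda>p. cos (f p))"
proof (induction k)
  case 0
  thus ?case by (auto intro: continuous_intros)
next
  case (Suc k)
  hence *: "Ck_on k S (\<lambda>p. sin (f p))" "Ck_on k S (\<lambda>p. cos (f p))"
    using Ck_on_Suc_D by blast+
  have "Ck_on k S (\<lambda>p. (-1) * sin (f p))" by (intro Ck_on_mult Ck_on_const assms *)
  with * Suc.prems show ?case
    by (intro conjI Ck_on_compose_Suc[where h = sin and h' = cos]
          Ck_on_compose_Suc[where h = cos and h' = "\<lambda>y. (-1) * sin y"] assms)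
       (auto intro!: derivative_eq_intros)
qed

named_theorems smooth_intros

lemma smooth_on_const [smooth_intros]: "smooth_on S (\<lambda>_. c)"
  and smooth_on_component [smooth_intros]: "smooth_on S (\<lambda>p. p $ j)"
  by (simp_all add: smooth_on_def Ck_on_const Ck_on_component)

context
  fixes S :: "(real^'n::finite) set"
  assumes S: "open S"
begin

lemma smooth_on_add [smooth_intros]:
  "smooth_on S f \<Longrightarrow> smooth_on S g \<Longrightarrow> smooth_on S (\<lambda>p. f p + g p)"
  and smooth_on_mult [smooth_intros]:
  "smooth_on S f \<Longrightarrow> smooth_on S g \<Longrightarrow> smooth_on S (\<lambda>p. f p * g p)"
  and smooth_on_inverse:
  "smooth_on S f \<Longrightarrow> (\<And>p. p \<in> S \<Longrightarrow> f p \<noteq> 0) \<Longrightarrow> smooth_on S (\<lambda>p. inverse (f p))"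
  and smooth_on_sqrt [smooth_intros]:
  "smooth_on S f \<Longrightarrow> (\<And>p. p \<in> S \<Longrightarrow> f p > 0) \<Longrightarrow> smooth_on S (\<lambda>p. sqrt (f p))"
  and smooth_on_sin [smooth_intros]: "smooth_on S f \<Longrightarrow> smooth_on S (\<lambda>p. sin (f p))"
  and smooth_on_cos [smooth_intros]: "smooth_on S f \<Longrightarrow> smooth_on S (\<lambda>p. cos (f p))"
  by (auto simp: smooth_on_def Ck_on_add Ck_on_mult Ck_on_inverse Ck_on_sqrt Ck_on_sin_cos S)

lemma smooth_on_minus [smooth_intros]: "smooth_on S f \<Longrightarrow> smooth_on S (\<lambda>p. - f p)"
  using smooth_on_mult[OF smooth_on_const[of S "-1"]] by simp

lemma smooth_on_diff [smooth_intros]: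
  "smooth_on S f \<Longrightarrow> smooth_on S g \<Longrightarrow> smooth_on S (\<lambda>p. f p - g p)"
  using smooth_on_add[OF _ smooth_on_minus, of f g] by simp

lemma smooth_on_divide [smooth_intros]:
  "smooth_on S f \<Longrightarrow> smooth_on S g \<Longrightarrow> (\<And>p. p \<in> S \<Longrightarrow> g p \<noteq> 0) \<Longrightarrow> smooth_on S (\<lambda>p. f p / g p)"
  using smooth_on_mult[OF _ smooth_on_inverse, of f g] by (simp add: divide_inverse)

lemma smooth_on_power [smooth_intros]: "smooth_on S f \<Longrightarrow> smooth_on S (\<lambda>p. f p ^ n)"
  by (induction n) (auto intro: smooth_intros smooth_on_mult)

end

lemma vector_4 [simp]:
  "(vector [w,x,y,z] :: ('a::zero)^4) $ 1 = w"
  "(vector [w,x,y,z] :: ('a::zero)^4) $ 2 = x"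
  "(vector [w,x,y,z] :: ('a::zero)^4) $ 3 = y"
  "(vector [w,x,y,z] :: ('a::zero)^4) $ 4 = z"
  unfolding vector_def by simp_all

section \<open>Curvature in local coordinates\<close>

lemma christoffel_cong:
  assumes "open S" "p \<in> S" "\<And>q. q \<in> S \<Longrightarrow> g q = g' q"
  shows "christoffel g k i j p = christoffel g' k i j p"
proof -
  have "pd m (\<lambda>q. g q $ a $ b) p = pd m (\<lambda>q. g' q $ a $ b) p" for m a b
    by (rule pd_cong[OF assms(1,2)]) (simp add: assms(3))
  thus ?thesis by (simp add: christoffel_def assms)
qed

lemma ricci_cong:
  assumes "open S" "p \<in> S" "\<And>q. q \<in> S \<Longrightarrow> g q = g' q"
  shows "ricci g i j p = ricci g' i j p"
proof -
  have "pd m (christoffel g a b c) p = pd m (christoffel g' a b c) p" for m a b c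
    using christoffel_cong[OF assms(1)] assms(3) by (intro pd_cong[OF assms(1,2)]) blast
  thus ?thesis by (simp add: ricci_def christoffel_cong[OF assms])
qed

text \<open>Curvature is local: a pulled-back pair \<open>(g, X)\<close> may be replaced by explicit formulas that hold
  only on the domain of a chart.\<close>
lemma generalised_ricci_soliton_at_cong:
  assumes "open S" "p \<in> S" "\<And>q. q \<in> S \<Longrightarrow> g q = g' q" "\<And>q. q \<in> S \<Longrightarrow> X q = X' q"
  shows "generalised_ricci_soliton_at c1 c2 lam g X p \<longleftrightarrow>
         generalised_ricci_soliton_at c1 c2 lam g' X' p"
proof -
  have "pd m (\<lambda>q. X q $ b) p = pd m (\<lambda>q. X' q $ b) p" for m b
    by (rule pd_cong[OF assms(1,2)]) (simp add: assms(4))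
  hence "nabla_form g X a b p = nabla_form g' X' a b p" for a b
    by (simp add: nabla_form_def christoffel_cong[OF assms(1-3)] assms(2,4))
  thus ?thesis
    by (simp add: generalised_ricci_soliton_at_def ricci_cong[OF assms(1-3)] assms(2,3,4))
qed

lemma pd_fun_component:
  assumes "(F has_real_derivative D) (at (p $ j))"
  shows "pd i (\<lambda>q. F (q $ j)) p = (if i = j then D else 0)"
proof -
  have "(\<lambda>q. q $ j) differentiable (at p)"
    by (simp add: bounded_linear_vec_nth bounded_linear_imp_differentiable)
  from pd_compose[OF this assms] show ?thesis by (simp add: pd_component)
qed

lemma matrix_inv_eqI:
  fixes A B :: "real^'n^'n"
  assumes "A ** B = mat 1"
  shows "matrix_inv A = B"
proof -
  have BA: "B ** A = mat 1" using assms matrix_left_right_inverse by blast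
  have "\<exists>C. A ** C = mat 1 \<and> C ** A = mat 1" using assms BA by blast
  hence "matrix_inv A ** A = mat 1" unfolding matrix_inv_def by (rule someI2_ex) blast
  hence "matrix_inv A ** (A ** B) = B" by (simp add: matrix_mul_assoc)
  thus ?thesis by (simp add: assms)
qed

lemma matrix_inv_2:
  fixes A :: "real^2^2"
  assumes "A $ 1 $ 1 * A $ 2 $ 2 - A $ 1 $ 2 * A $ 2 $ 1 \<noteq> 0" (is "?D \<noteq> 0")
  shows "matrix_inv A = vector [vector [A $ 2 $ 2 / ?D, - A $ 1 $ 2 / ?D],
                                vector [- A $ 2 $ 1 / ?D, A $ 1 $ 1 / ?D]]"
  using assms
  by (intro matrix_inv_eqI)
     (simp add: matrix_matrix_mult_def mat_def vec_eq_iff forall_2 sum_2 divide_simps)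

text \<open>Every member of the family has the form \<open>f(z) dx\<^sup>2 + \<alpha>\<^sup>2 dz\<^sup>2 / f(z)\<close>, in which the area
  form has constant coefficients.\<close>
context
  fixes I :: "real set" and f f' :: "real \<Rightarrow> real" and \<alpha> :: real and g :: "2 metric_field"
  assumes I: "open I" and \<alpha>: "\<alpha> \<noteq> 0"
    and f_pos: "\<forall>z\<in>I. f z > 0"
    and f': "\<forall>z\<in>I. (f has_real_derivative f' z) (at z)"
    and g_def: "g = (\<lambda>p. vector [vector [f (p $ 2), 0], vector [0, \<alpha>^2 / f (p $ 2)]])"
begin

lemma christoffel_profile:
  assumes "p $ 2 \<in> I"
  shows "christoffel g 1 1 1 p = 0" "christoffel g 1 1 2 p = f' (p $ 2) / (2 * f (p $ 2))"
    "christoffel g 1 2 1 p = f' (p $ 2) / (2 * f (p $ 2))" "christoffel g 1 2 2 p = 0"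
    "christoffel g 2 1 1 p = - (f (p $ 2) * f' (p $ 2)) / (2 * \<alpha>^2)" "christoffel g 2 1 2 p = 0"
    "christoffel g 2 2 1 p = 0" "christoffel g 2 2 2 p = - f' (p $ 2) / (2 * f (p $ 2))"
proof -
  note nz = less_imp_neq[OF f_pos[rule_format, OF assms], symmetric]
  have inv: "matrix_inv (g p) = vector [vector [1 / f (p $ 2), 0], vector [0, f (p $ 2) / \<alpha>^2]]"
    unfolding g_def by (subst matrix_inv_2) (use nz \<alpha> in \<open>simp_all add: vec_eq_iff forall_2\<close>)
  have d1: "pd i (\<lambda>q. f (q $ 2)) p = (if i = 2 then f' (p $ 2) else 0)" for i
    by (rule pd_fun_component[OF f'[rule_format, OF assms]])
  have d2: "pd i (\<lambda>q. \<alpha>^2 / f (q $ 2)) p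
      = (if i = 2 then - (\<alpha>^2 * f' (p $ 2)) / (f (p $ 2))^2 else 0)" for i
    by (rule pd_fun_component)
       (use nz in \<open>auto intro!: derivative_eq_intros f'[rule_format, OF assms] simp: power2_eq_square\<close>)
  show "christoffel g 1 1 1 p = 0" "christoffel g 1 1 2 p = f' (p $ 2) / (2 * f (p $ 2))"
    "christoffel g 1 2 1 p = f' (p $ 2) / (2 * f (p $ 2))" "christoffel g 1 2 2 p = 0"
    "christoffel g 2 1 1 p = - (f (p $ 2) * f' (p $ 2)) / (2 * \<alpha>^2)" "christoffel g 2 1 2 p = 0"
    "christoffel g 2 2 1 p = 0" "christoffel g 2 2 2 p = - f' (p $ 2) / (2 * f (p $ 2))"
    using nz \<alpha> unfolding christoffel_def sum_2 inv
    by (simp_all add: g_def d1 d2) (simp_all add: power2_eq_square)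
qed

text \<open>In the coordinate \<open>w = \<alpha> z\<close> the metric is \<open>f dx\<^sup>2 + dw\<^sup>2 / f\<close>, whose Gauss curvature is
  minus half the second derivative of \<open>f\<close> with respect to \<open>w\<close>.\<close>
lemma ricci_profile:
  assumes p: "p $ 2 \<in> I" and f'': "(f' has_real_derivative f'') (at (p $ 2))"
  shows "ricci g i j p = - f'' / (2 * \<alpha>^2) * g p $ i $ j"
proof -
  note nz = less_imp_neq[OF f_pos[rule_format, OF p], symmetric]
  define D where "D = {p::real^2. p $ 2 \<in> I}"
  have D: "open D" "p \<in> D"
    using p open_vimage[OF I continuous_on_component[OF continuous_on_id], of 2]
    by (simp_all add: D_def vimage_def)
  have pdC: "pd m (christoffel g a b c) p = (if m = 2 then F' else 0)"
    if "\<And>q. q \<in> D \<Longrightarrow> christoffel g a b c q = F (q $ 2)" "(F has_real_derivative F') (at (p $ 2))"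
    for m a b c F F'
    using pd_cong[OF D that(1)] pd_fun_component[OF that(2)] by simp
  have A: "((\<lambda>z. f' z / (2 * f z)) has_real_derivative
      f'' / (2 * f (p $ 2)) - (f' (p $ 2))^2 / (2 * (f (p $ 2))^2)) (at (p $ 2))"
    using nz by (auto intro!: derivative_eq_intros f'[rule_format, OF p] f'' simp: field_simps power2_eq_square)
  have A': "((\<lambda>z. - f' z / (2 * f z)) has_real_derivative
      - (f'' / (2 * f (p $ 2)) - (f' (p $ 2))^2 / (2 * (f (p $ 2))^2))) (at (p $ 2))"
    using DERIV_minus[OF A] by simp
  have B: "((\<lambda>z. - (f z * f' z) / (2 * \<alpha>^2)) has_real_derivative
      - (f (p $ 2) * f'' + (f' (p $ 2))^2) / (2 * \<alpha>^2)) (at (p $ 2))"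
    using \<alpha> by (auto intro!: derivative_eq_intros f'[rule_format, OF p] f'' simp: field_simps power2_eq_square)
  have Z: "((\<lambda>z. 0::real) has_real_derivative 0) (at (p $ 2))" by simp
  have "q $ 2 \<in> I" if "q \<in> D" for q using that by (simp add: D_def)
  note C = christoffel_profile[OF this]
  have d: "pd m (christoffel g 1 1 1) p = 0" "pd m (christoffel g 1 2 2) p = 0"
    "pd m (christoffel g 2 1 2) p = 0" "pd m (christoffel g 2 2 1) p = 0"
    "pd m (christoffel g 1 1 2) p = (if m = 2 then
      f'' / (2 * f (p $ 2)) - (f' (p $ 2))^2 / (2 * (f (p $ 2))^2) else 0)"
    "pd m (christoffel g 1 2 1) p = (if m = 2 then
      f'' / (2 * f (p $ 2)) - (f' (p $ 2))^2 / (2 * (f (p $ 2))^2) else 0)"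
    "pd m (christoffel g 2 1 1) p = (if m = 2 then
      - (f (p $ 2) * f'' + (f' (p $ 2))^2) / (2 * \<alpha>^2) else 0)"
    "pd m (christoffel g 2 2 2) p = (if m = 2 then
      - (f'' / (2 * f (p $ 2)) - (f' (p $ 2))^2 / (2 * (f (p $ 2))^2)) else 0)" for m
    using pdC[OF _ Z, OF C(1)] pdC[OF _ Z, OF C(4)] pdC[OF _ Z, OF C(6)] pdC[OF _ Z, OF C(7)]
      pdC[OF _ A, OF C(2)] pdC[OF _ A, OF C(3)] pdC[OF _ B, OF C(5)] pdC[OF _ A', OF C(8)]
    by simp_all
  have gp: "g p $ 1 $ 1 = f (p $ 2)" "g p $ 1 $ 2 = 0" "g p $ 2 $ 1 = 0" "g p $ 2 $ 2 = \<alpha>^2 / f (p $ 2)"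
    by (simp_all add: g_def)
  show ?thesis
    using exhaust_2[of i] exhaust_2[of j] nz \<alpha>
    unfolding ricci_def sum_2
    by (auto simp: d christoffel_profile[OF p] gp field_simps power2_eq_square)
qed

end

section \<open>The family on the coordinate strip\<close>

lemma open_xz_domain: "open xz_domain"
proof -
  have "xz_domain = (\<lambda>p. p $ 2) -` {-1<..<1}" by (auto simp: xz_domain_def)
  moreover have "open ..."
    by (intro open_vimage open_greaterThanLessThan continuous_intros)
  ultimately show ?thesis by simp
qed

lemma sq_less_1_iff: "z^2 < 1 \<longleftrightarrow> -1 < z \<and> z < (1::real)"
  using abs_square_less_1[of z] by auto

lemma one_plus_sq_pos: "1 + z^2 > (0::real)"
  by (simp add: add_pos_nonneg)

lemma one_plus_sq_nz [simp]: "1 + z^2 \<noteq> (0::real)"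
  using one_plus_sq_pos[of z] by linarith

lemma DERIV_g_fam_profile:
  "((\<lambda>z. (1 - z^2) / (1 + z^2)) has_real_derivative - 4 * z / (1 + z^2)^2) (at z)"
proof -
  have "((\<lambda>z. (1 - z^2) / (1 + z^2)) has_real_derivative
      ((- 2 * z) * (1 + z^2) - (1 - z^2) * (2 * z)) / (1 + z^2)^2) (at z)"
    by (auto intro!: derivative_eq_intros simp: power2_eq_square[of "1 + z^2"])
  moreover have "(- 2 * z) * (1 + z^2) - (1 - z^2) * (2 * z) = - 4 * z"
    by (simp add: algebra_simps)
  ultimately show ?thesis by simp
qed

lemma DERIV_DERIV_g_fam_profile:
  "((\<lambda>z. - 4 * z / (1 + z^2)^2) has_real_derivative (12 * z^2 - 4) / (1 + z^2)^3) (at z)"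
proof -
  have "((\<lambda>z. - 4 * z / (1 + z^2)^2) has_real_derivative
      ((- 4) * (1 + z^2)^2 - (- 4 * z) * (2 * (1 + z^2) * (2 * z))) / ((1 + z^2)^2 * (1 + z^2)^2)) (at z)"
    by (rule derivative_eq_intros refl | simp)+
  moreover have "(- 4) * (1 + z^2)^2 - (- 4 * z) * (2 * (1 + z^2) * (2 * z)) = (12 * z^2 - 4) * (1 + z^2)"
    by algebra
  moreover have "((1 + z^2)^2 * (1 + z^2)^2) = (1 + z^2)^3 * (1 + z^2)" by algebra
  ultimately show ?thesis by simp
qed

lemma g_fam_nth [simp]:
  "g_fam \<alpha> p $ 1 $ 1 = (1 - (p $ 2)^2) / (1 + (p $ 2)^2)" "g_fam \<alpha> p $ 1 $ 2 = 0"
  "g_fam \<alpha> p $ 2 $ 1 = 0" "g_fam \<alpha> p $ 2 $ 2 = \<alpha>^2 * (1 + (p $ 2)^2) / (1 - (p $ 2)^2)"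
  by (simp_all add: g_fam_def Let_def)

lemma X_fam_nth [simp]:
  "X_fam \<alpha> p $ 1 = (1 - (p $ 2)^2) / (\<alpha> * (1 + (p $ 2)^2)^2)" "X_fam \<alpha> p $ 2 = p $ 2 / (1 + (p $ 2)^2)"
  by (simp_all add: X_fam_def Let_def)

lemma riemannian_g_fam:
  assumes "\<alpha> \<noteq> 0"
  shows "riemannian_on xz_domain (g_fam \<alpha>)"
  unfolding riemannian_on_def
proof (intro conjI ballI allI impI)
  have *: "(p $ 2)\<^sup>2 \<noteq> 1" if "p \<in> xz_domain" for p
    using that sq_less_1_iff[of "p $ 2"] by (simp add: xz_domain_def)
  show "smooth_mat_on xz_domain (g_fam \<alpha>)"
    by (auto simp: smooth_mat_on_def forall_2 * intro!: smooth_intros open_xz_domain)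
next
  fix p :: "real^2" assume p: "p \<in> xz_domain"
  hence pos: "1 - (p $ 2)\<^sup>2 > 0" using sq_less_1_iff[of "p $ 2"] by (auto simp: xz_domain_def)
  show "transpose (g_fam \<alpha> p) = g_fam \<alpha> p"
    by (simp add: transpose_def vec_eq_iff forall_2)
  fix u :: "real^2" assume "u \<noteq> 0"
  hence u: "u $ 1 \<noteq> 0 \<or> u $ 2 \<noteq> 0" by (simp add: vec_eq_iff forall_2)
  have "u \<bullet> (g_fam \<alpha> p *v u) = g_fam \<alpha> p $ 1 $ 1 * (u $ 1)^2 + g_fam \<alpha> p $ 2 $ 2 * (u $ 2)^2"
    by (simp add: inner_vec_def sum_2 matrix_vector_mult_def power2_eq_square del: g_fam_nth(1,4))
  moreover have "g_fam \<alpha> p $ 1 $ 1 > 0" "g_fam \<alpha> p $ 2 $ 2 > 0"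
    using pos one_plus_sq_pos assms by simp_all
  ultimately show "u \<bullet> (g_fam \<alpha> p *v u) > 0"
    using u by (smt (verit) mult_nonneg_nonneg mult_pos_pos zero_less_power2 zero_le_power2)
qed

lemma vacuum_near_horizon_fam:
  assumes \<alpha>: "\<alpha> \<noteq> 0"
  shows "vacuum_near_horizon_on xz_domain (g_fam \<alpha>) (X_fam \<alpha>)"
  unfolding generalised_ricci_soliton_on_def
proof (intro conjI ballI open_xz_domain riemannian_g_fam \<alpha>)
  show "smooth_vec_on xz_domain (X_fam \<alpha>)"
    by (auto simp: smooth_vec_on_def forall_2 \<alpha> intro!: smooth_intros open_xz_domain)
next
  fix p :: "real^2" assume "p \<in> xz_domain"
  define z where "z = p $ 2"
  \<comment> \<open>With \<open>n\<close> kept atomic, all denominators are monomials in \<open>n\<close>, \<open>2 - n = 1 - z\<^sup>2\<close> and \<open>\<alpha>\<close>.\<close>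
  define n where "n = 1 + z^2"
  have z: "-1 < z" "z < 1" using \<open>p \<in> xz_domain\<close> by (simp_all add: xz_domain_def z_def)
  have n: "n > 0" "z^2 = n - 1" "n < 2"
    using one_plus_sq_pos[of z] sq_less_1_iff[of z] z by (auto simp: n_def)
  define I where "I = {-1<..<1::real}"
  let ?f = "\<lambda>z::real. (1 - z^2) / (1 + z^2)"
  let ?f' = "\<lambda>z::real. - 4 * z / (1 + z^2)^2"
  let ?f'' = "\<lambda>z::real. (12 * z^2 - 4) / (1 + z^2)^3"
  have prem: "open I" "\<forall>z\<in>I. ?f z > 0"
    "\<forall>z\<in>I. (?f has_real_derivative ?f' z) (at z)"
    "\<forall>z\<in>I. (?f' has_real_derivative ?f'' z) (at z)"
    using DERIV_g_fam_profile DERIV_DERIV_g_fam_profile by (simp_all add: I_def sq_less_1_iff one_plus_sq_pos)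
  have g: "g_fam \<alpha> = (\<lambda>p. vector [vector [?f (p $ 2), 0], vector [0, \<alpha>^2 / ?f (p $ 2)]])"
    by (rule ext) (simp add: g_fam_def Let_def)
  have pI: "p $ 2 \<in> I" using z by (simp add: I_def z_def)
  note C = christoffel_profile[where f = ?f and f' = ?f', OF prem(1) \<alpha> prem(2,3) g pI, folded z_def]
  note R = ricci_profile[where f = ?f and f' = ?f', OF prem(1) \<alpha> prem(2,3) g pI prem(4)[rule_format, OF pI], folded z_def]
  have X1: "pd i (\<lambda>q. X_fam \<alpha> q $ 1) p = (if i = 2 then (2 * z^3 - 6 * z) / (\<alpha> * n^3) else 0)" for i
    unfolding X_fam_nth
    apply (rule pd_fun_component)
    using \<alpha> n(1) apply (auto intro!: derivative_eq_intros simp: z_def[symmetric] n_def[symmetric])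
    apply (simp add: divide_simps)
    apply (simp add: n_def)
    apply algebra
    done
  have X2: "pd i (\<lambda>q. X_fam \<alpha> q $ 2) p = (if i = 2 then (1 - z^2) / n^2 else 0)" for i
    unfolding X_fam_nth
    apply (rule pd_fun_component)
    using \<alpha> n(1) apply (auto intro!: derivative_eq_intros simp: z_def[symmetric] n_def[symmetric])
    apply (simp add: divide_simps)
    apply (simp add: n_def)
    apply algebra
    done
  show "vacuum_near_horizon_at (g_fam \<alpha>) (X_fam \<alpha>) p"
    unfolding generalised_ricci_soliton_at_def forall_2 nabla_form_def sum_2 X1 X2 C R
    using n \<alpha> apply (auto simp: z_def[symmetric] n_def[symmetric])
    apply (simp_all add: divide_simps)
    apply (algebra | simp)+
    done
qed

section \<open>The rectangle and the sphere\<close>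

lemma closed_segment_0_iff:
  "(y::real) \<in> closed_segment 0 b \<longleftrightarrow> (\<exists>u. 0 \<le> u \<and> u \<le> 1 \<and> y = u * b)"
  by (auto simp: in_segment)

lemma closed_segment_0_scale:
  assumes "m \<noteq> (0::real)"
  shows "m * y \<in> closed_segment 0 (m * b) \<longleftrightarrow> y \<in> closed_segment 0 b"
  using assms by (auto simp: closed_segment_0_iff)

lemma bij_betw_polar_to_xz:
  assumes "\<alpha> \<noteq> 0" "m * k = 2 * \<alpha>"
  shows "bij_betw (polar_to_xz m) (polar_rectangle k) (xz_rectangle \<alpha>)"
proof (rule bij_betwI[where g = "\<lambda>p. vector [arccos (p $ 2), p $ 1 / m]"])
  have m: "m \<noteq> 0" using assms by auto
  have seg: "m * y \<in> closed_segment 0 (4 * \<alpha> * pi) \<longleftrightarrow> y \<in> closed_segment 0 (2 * pi * k)" for y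
  proof -
    have "4 * \<alpha> * pi = m * (2 * pi * k)" using assms(2) by algebra
    thus ?thesis using closed_segment_0_scale[OF m] by metis
  qed
  show "polar_to_xz m \<in> polar_rectangle k \<rightarrow> xz_rectangle \<alpha>"
    by (auto simp: polar_to_xz_def polar_rectangle_def xz_rectangle_def seg)
  show "(\<lambda>p. vector [arccos (p $ 2), p $ 1 / m]) \<in> xz_rectangle \<alpha> \<rightarrow> polar_rectangle k"
    using seg[of "x / m" for x] m
    by (auto simp: polar_rectangle_def xz_rectangle_def arccos_lbound arccos_ubound)
  show "vector [arccos (polar_to_xz m q $ 2), polar_to_xz m q $ 1 / m] = q"
    if "q \<in> polar_rectangle k" for q
    using that m by (simp add: polar_to_xz_def polar_rectangle_def vec_eq_iff forall_2 arccos_cos)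
  show "polar_to_xz m (vector [arccos (p $ 2), p $ 1 / m]) = p" if "p \<in> xz_rectangle \<alpha>" for p
    using that m by (simp add: polar_to_xz_def xz_rectangle_def vec_eq_iff forall_2)
qed

lemma sphere_param_nth [simp]:
  "sphere_param \<alpha> p $ 1 = sqrt (1 - (p $ 2)^2) * cos (p $ 1 / (2 * \<alpha>))"
  "sphere_param \<alpha> p $ 2 = sqrt (1 - (p $ 2)^2) * sin (p $ 1 / (2 * \<alpha>))"
  "sphere_param \<alpha> p $ 3 = p $ 2"
  by (simp_all add: sphere_param_def Let_def)

lemma mem_S2_iff: "p \<in> S2 \<longleftrightarrow> (p $ 1)^2 + (p $ 2)^2 + (p $ 3)^2 = 1"
  by (simp add: norm_vec_def L2_set_def sum_3)

lemma continuous_sphere_param: "continuous_on S (sphere_param \<alpha>)"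
proof -
  have "continuous_on S (\<lambda>p. sphere_param \<alpha> p $ 1)" "continuous_on S (\<lambda>p. sphere_param \<alpha> p $ 2)"
    "continuous_on S (\<lambda>p. sphere_param \<alpha> p $ 3)"
    unfolding sphere_param_nth divide_inverse by (intro continuous_intros)+
  hence "continuous_on S (\<lambda>p. sphere_param \<alpha> p $ i)" for i
    using exhaust_3[of i] by metis
  hence "continuous_on S (\<lambda>p. \<chi> i. sphere_param \<alpha> p $ i)" by (rule continuous_on_vec_lambda)
  thus ?thesis by (simp only: vec_nth_inverse)
qed

lemma sphere_param_in_S2:
  assumes "\<bar>p $ 2\<bar> \<le> 1"
  shows "sphere_param \<alpha> p \<in> S2"
proof -
  have "(p $ 2)^2 \<le> 1" using assms by (simp add: abs_square_le_1)
  moreover have "(1 - (p $ 2)^2) * (cos (p $ 1 / (2 * \<alpha>)))^2 + (1 - (p $ 2)^2) * (sin (p $ 1 / (2 * \<alpha>)))^2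
    = 1 - (p $ 2)^2"
    by (simp flip: distrib_left)
  ultimately show ?thesis unfolding mem_S2_iff by (simp add: power_mult_distrib)
qed

lemma S2_sphere_param:
  assumes "\<alpha> \<noteq> 0" "P \<in> S2"
  obtains t where "0 \<le> t" "t < 2 * pi" "P = sphere_param \<alpha> (vector [2 * \<alpha> * t, P $ 3])"
proof -
  define z where "z = P $ 3"
  have P: "(P $ 1)^2 + (P $ 2)^2 = 1 - z^2" using assms(2) unfolding mem_S2_iff z_def by linarith
  hence z: "1 - z^2 \<ge> 0" by (metis sum_power2_ge_zero)
  have "\<exists>t. 0 \<le> t \<and> t < 2 * pi \<and> P $ 1 = sqrt (1 - z^2) * cos t \<and> P $ 2 = sqrt (1 - z^2) * sin t"
  proof (cases "1 - z^2 = 0")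
    case True
    thus ?thesis using P by (auto intro!: exI[of _ 0] simp: sum_power2_eq_zero_iff)
  next
    case False
    define s where "s = sqrt (1 - z^2)"
    have s: "s \<noteq> 0" "s^2 = 1 - z^2" using False z by (simp_all add: s_def)
    have "(P $ 1 / s)^2 + (P $ 2 / s)^2 = 1"
      using P s False by (simp add: power_divide flip: add_divide_distrib)
    then obtain t where "0 \<le> t" "t < 2 * pi" "P $ 1 / s = cos t" "P $ 2 / s = sin t"
      using sincos_total_2pi by metis
    thus ?thesis using s by (intro exI[of _ t]) (auto simp: field_simps simp flip: s_def)
  qed
  then obtain t where "0 \<le> t" "t < 2 * pi" "P $ 1 = sqrt (1 - z^2) * cos t" "P $ 2 = sqrt (1 - z^2) * sin t"
    by blast
  thus ?thesis using assms(1) by (intro that[of t]) (simp_all add: vec_eq_iff forall_3 z_def)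
qed

lemma sphere_param_image:
  assumes "\<alpha> \<noteq> 0"
  shows "sphere_param \<alpha> ` xz_rectangle \<alpha> = S2"
proof (intro equalityI subsetI)
  fix P assume "P \<in> sphere_param \<alpha> ` xz_rectangle \<alpha>"
  thus "P \<in> S2" using sphere_param_in_S2 by (auto simp: xz_rectangle_def simp del: mem_sphere)
next
  fix P :: "real^3" assume P: "P \<in> S2"
  then obtain t where t: "0 \<le> t" "t < 2 * pi" "P = sphere_param \<alpha> (vector [2 * \<alpha> * t, P $ 3])"
    using S2_sphere_param[OF assms] by blast
  have "(P $ 3)^2 \<le> 1" using P unfolding mem_S2_iff by (smt (verit) zero_le_power2)
  hence "\<bar>P $ 3\<bar> \<le> 1" by (simp add: abs_square_le_1)
  hence "vector [2 * \<alpha> * t, P $ 3] \<in> xz_rectangle \<alpha>"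
    using t(1,2) by (auto simp: xz_rectangle_def closed_segment_0_iff intro!: exI[of _ "t / (2 * pi)"])
  thus "P \<in> sphere_param \<alpha> ` xz_rectangle \<alpha>" using t(3) by blast
qed

text \<open>The azimuth of \<open>sphere_param \<alpha> p\<close> is \<open>x / (2 \<alpha>)\<close>, which makes \<open>4 \<alpha> \<pi>\<close> the period of \<open>x\<close>.\<close>
lemma sphere_param_eq_iff:
  assumes "\<bar>p $ 2\<bar> < 1" "\<alpha> \<noteq> 0"
  shows "sphere_param \<alpha> p = sphere_param \<alpha> q \<longleftrightarrow>
         p $ 2 = q $ 2 \<and> (\<exists>n::int. p $ 1 = q $ 1 + 4 * \<alpha> * pi * n)"
proof -
  have "sqrt (1 - (p $ 2)^2) \<noteq> 0" using assms(1) by (simp flip: abs_square_less_1)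
  hence "sphere_param \<alpha> p = sphere_param \<alpha> q \<longleftrightarrow> p $ 2 = q $ 2 \<and>
      sin (p $ 1 / (2 * \<alpha>)) = sin (q $ 1 / (2 * \<alpha>)) \<and> cos (p $ 1 / (2 * \<alpha>)) = cos (q $ 1 / (2 * \<alpha>))"
    by (auto simp: vec_eq_iff forall_3)
  also have "\<dots> \<longleftrightarrow> p $ 2 = q $ 2 \<and> (\<exists>n::int. p $ 1 / (2 * \<alpha>) = q $ 1 / (2 * \<alpha>) + 2 * pi * n)"
    by (simp add: sin_cos_eq_iff)
  also have "\<dots> \<longleftrightarrow> p $ 2 = q $ 2 \<and> (\<exists>n::int. p $ 1 = q $ 1 + 4 * \<alpha> * pi * n)"
    using assms(2) by (simp add: field_simps)
  finally show ?thesis .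
qed

lemma sphere_param_glue:
  assumes \<alpha>: "\<alpha> \<noteq> 0" and p: "p \<in> xz_rectangle \<alpha>" and q: "q \<in> xz_rectangle \<alpha>"
  shows "sphere_param \<alpha> p = sphere_param \<alpha> q \<longleftrightarrow> sphere_glue \<alpha> p q"
proof (cases "p $ 2 = 1 \<or> p $ 2 = -1")
  case True
  hence "(p $ 2)^2 = 1" by auto
  hence "sphere_param \<alpha> p = sphere_param \<alpha> q \<longleftrightarrow> p $ 2 = q $ 2"
    by (cases "p $ 2 = q $ 2") (simp_all add: vec_eq_iff forall_3)
  thus ?thesis using True unfolding sphere_glue_def by blast
next
  case False
  hence z: "\<bar>p $ 2\<bar> < 1" using p by (auto simp: xz_rectangle_def)
  obtain u v where uv: "0 \<le> u" "u \<le> 1" "p $ 1 = u * (4 * \<alpha> * pi)" "0 \<le> v" "v \<le> 1" "q $ 1 = v * (4 * \<alpha> * pi)"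
    using p q by (auto simp: xz_rectangle_def closed_segment_0_iff)
  define c where "c = 4 * \<alpha> * pi"
  have c: "c \<noteq> 0" using \<alpha> by (simp add: c_def)
  have "(\<exists>n::int. p $ 1 = q $ 1 + c * n) \<longleftrightarrow> (\<exists>n::int. u = v + n)"
  proof -
    have "u * c = v * c + c * n \<longleftrightarrow> u = v + n" for n
      using c by (metis distrib_left mult.commute mult_left_cancel)
    thus ?thesis by (simp add: uv c_def)
  qed
  also have "\<dots> \<longleftrightarrow> u = v \<or> {u, v} = {0, 1}"
  proof
    \<comment> \<open>Both \<open>u\<close> and \<open>v\<close> lie in the unit interval, so a shift by a full period relates its end points only.\<close>
    assume "\<exists>n::int. u = v + n"
    then obtain n :: int where n: "u = v + n" by blast
    hence "-1 \<le> real_of_int n" "real_of_int n \<le> 1" using uv by linarith+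
    hence "n = -1 \<or> n = 0 \<or> n = 1" by linarith
    thus "u = v \<or> {u, v} = {0, 1}" using n uv by auto
  next
    assume "u = v \<or> {u, v} = {0, 1}"
    hence "u = v + of_int 0 \<or> u = v + of_int 1 \<or> u = v + of_int (-1)"
      by (auto simp: doubleton_eq_iff)
    thus "\<exists>n::int. u = v + n" by blast
  qed
  also have "\<dots> \<longleftrightarrow> p $ 1 = q $ 1 \<or> {p $ 1, q $ 1} = {0, c}"
    using c by (simp add: uv doubleton_eq_iff flip: c_def)
  finally show ?thesis
    unfolding sphere_param_eq_iff[OF z \<alpha>] using False by (simp add: sphere_glue_def c_def)
qed

lemma rot_mult_nth [simp]:
  "(rot t *v u) $ 1 = cos t * u $ 1 - sin t * u $ 2"
  "(rot t *v u) $ 2 = sin t * u $ 1 + cos t * u $ 2"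
  "(rot t *v u) $ 3 = u $ 3"
  by (simp_all add: rot_def matrix_vector_mult_def sum_3)

lemma sphere_param_rot:
  "sphere_param \<alpha> (vector [x + t, z]) = rot (t / (2 * \<alpha>)) *v sphere_param \<alpha> (vector [x, z])"
  by (simp add: vec_eq_iff forall_3 add_divide_distrib cos_add sin_add algebra_simps)

section \<open>The extension to the sphere\<close>

text \<open>The first factor need not be differentiable. In \<open>g\<^sup>-\<^sup>1 \<partial>g\<close> at a point where \<open>\<partial>g\<close>
  vanishes, this saves differentiating the inverse matrix.\<close>
lemma DERIV_mult_vanishing:
  fixes h k :: "real \<Rightarrow> real"
  assumes "isCont h x" "k x = 0" "(k has_real_derivative D) (at x)"
  shows "((\<lambda>t. h t * k t) has_real_derivative h x * D) (at x)"
proof -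
  obtain c where c: "\<And>t. k t - k x = c t * (t - x)" "isCont c x" "c x = D"
    using assms(3) unfolding CARAT_DERIV by blast
  have "h t * k t - h x * k x = (h t * c t) * (t - x)" for t
    using c(1)[of t] assms(2) by simp
  moreover have "isCont (\<lambda>t. h t * c t) x" using assms(1) c(2) by (rule isCont_mult)
  ultimately show ?thesis
    unfolding CARAT_DERIV using c(3) by (intro exI[of _ "\<lambda>t. h t * c t"]) simp
qed

text \<open>At a point where the metric is stationary the Christoffel symbols vanish, and their derivatives
  involve only the second derivatives \<open>H m l i j\<close> (for \<open>\<partial>\<^sub>m \<partial>\<^sub>l g\<^sub>i\<^sub>j\<close>) of the metric.\<close>
lemma christoffel_critical:
  fixes g :: "'n::finite metric_field"
  assumes crit: "\<And>l i j. pd l (\<lambda>q. g q $ i $ j) p = 0"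
    and hess: "\<And>m l i j. ((\<lambda>t. pd l (\<lambda>q. g q $ i $ j) (p + t *\<^sub>R axis m 1)) has_real_derivative H m l i j) (at 0)"
    and cont: "\<And>m k l. isCont (\<lambda>t. matrix_inv (g (p + t *\<^sub>R axis m 1)) $ k $ l) 0"
  shows "christoffel g k i j p = 0"
    and "pd m (christoffel g k i j) p =
      (\<Sum>l\<in>UNIV. matrix_inv (g p) $ k $ l * (H m i l j + H m j i l - H m l i j)) / 2"
proof -
  show "christoffel g k i j p = 0" by (simp add: christoffel_def crit)
  have "((\<lambda>t. matrix_inv (g (p + t *\<^sub>R axis m 1)) $ k $ l *
      (pd i (\<lambda>q. g q $ l $ j) (p + t *\<^sub>R axis m 1) + pd j (\<lambda>q. g q $ i $ l) (p + t *\<^sub>R axis m 1)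
        - pd l (\<lambda>q. g q $ i $ j) (p + t *\<^sub>R axis m 1)))
      has_real_derivative matrix_inv (g (p + 0 *\<^sub>R axis m 1)) $ k $ l * (H m i l j + H m j i l - H m l i j)) (at 0)" for l
    by (rule DERIV_mult_vanishing[OF cont]) (auto intro!: derivative_eq_intros hess simp: crit)
  thus "pd m (christoffel g k i j) p =
      (\<Sum>l\<in>UNIV. matrix_inv (g p) $ k $ l * (H m i l j + H m j i l - H m l i j)) / 2"
    unfolding christoffel_def by (intro pd_eqI DERIV_cdivide DERIV_sum) simp
qed

lemma isCont_matrix_inv_2:
  fixes A :: "real \<Rightarrow> real^2^2"
  assumes cont: "\<And>i j. isCont (\<lambda>t. A t $ i $ j) x"
    and det: "A x $ 1 $ 1 * A x $ 2 $ 2 - A x $ 1 $ 2 * A x $ 2 $ 1 \<noteq> 0"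
  shows "isCont (\<lambda>t. matrix_inv (A t) $ k $ l) x"
proof -
  let ?D = "\<lambda>t. A t $ 1 $ 1 * A t $ 2 $ 2 - A t $ 1 $ 2 * A t $ 2 $ 1"
  let ?B = "\<lambda>t. vector [vector [A t $ 2 $ 2 / ?D t, - A t $ 1 $ 2 / ?D t],
                         vector [- A t $ 2 $ 1 / ?D t, A t $ 1 $ 1 / ?D t]] :: real^2^2"
  have D: "isCont ?D x" by (intro continuous_intros cont)
  have "isCont (\<lambda>t. A t $ i $ j / ?D t) x" for i j
    by (rule isCont_divide[OF cont D det])
  hence B: "isCont (\<lambda>t. ?B t $ k $ l) x"
    using exhaust_2[of k] exhaust_2[of l] by (elim disjE) (simp_all add: continuous_minus)
  have "\<forall>\<^sub>F t in nhds x. ?D t \<noteq> 0"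
    using tendsto_imp_eventually_ne[OF D[unfolded isCont_def] det] det
    by (simp add: eventually_nhds_conv_at)
  hence "\<forall>\<^sub>F t in nhds x. matrix_inv (A t) $ k $ l = ?B t $ k $ l"
    by eventually_elim (simp add: matrix_inv_2)
  from isCont_cong[OF this] show ?thesis using B by (rule iffD2)
qed

text \<open>The ambient tensor \<open>\<alpha>\<^sup>2 / (1 + Z\<^sup>2) (4 dX\<^sup>2 + 4 dY\<^sup>2 + (1 - Z\<^sup>2) dZ\<^sup>2)\<close>. To find
  it, let \<open>\<phi> = x / (2 \<alpha>)\<close> and \<open>\<rho>\<^sup>2 = 1 - z\<^sup>2\<close>. On the sphere
  \<open>\<rho>\<^sup>2 d\<phi>\<^sup>2 = dX\<^sup>2 + dY\<^sup>2 - (z\<^sup>2 / \<rho>\<^sup>2) dz\<^sup>2\<close>, so \<open>f dx\<^sup>2\<close> is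
  \<open>4 \<alpha>\<^sup>2 / (1 + z\<^sup>2)\<close> times this; the remaining multiple of \<open>dz\<^sup>2\<close> is
  \<open>\<alpha>\<^sup>2 ((1 + z\<^sup>2)\<^sup>2 - 4 z\<^sup>2) / ((1 + z\<^sup>2) (1 - z\<^sup>2))\<close>, in which \<open>1 - z\<^sup>2\<close>
  cancels.\<close>
definition horizon_metric :: "real \<Rightarrow> 3 metric_field" where
  "horizon_metric \<alpha> P = (let Z = P $ 3; c = \<alpha>^2 / (1 + Z^2) in
    vector [vector [4 * c, 0, 0], vector [0, 4 * c, 0], vector [0, 0, (1 - Z^2) * c]])"

text \<open>The ambient form \<open>2 (X dY - Y dX) / (1 + Z\<^sup>2)\<^sup>2 + Z dZ / (1 + Z\<^sup>2)\<close>, obtained from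
  \<open>\<rho>\<^sup>2 d\<phi> = X dY - Y dX\<close>.\<close>
definition horizon_form :: "3 vec_field" where
  "horizon_form P = (let Z = P $ 3 in
    vector [- 2 * P $ 2 / (1 + Z^2)^2, 2 * P $ 1 / (1 + Z^2)^2, Z / (1 + Z^2)])"

lemma horizon_metric_apply:
  "u \<bullet> (horizon_metric \<alpha> P *v v) =
    \<alpha>^2 / (1 + (P $ 3)^2) * (4 * (u $ 1 * v $ 1 + u $ 2 * v $ 2) + (1 - (P $ 3)^2) * (u $ 3 * v $ 3))"
  by (simp add: horizon_metric_def Let_def inner_vec_def matrix_vector_mult_def sum_3 divide_simps)
     (simp add: algebra_simps)

lemma horizon_form_apply:
  "horizon_form P \<bullet> u = 2 * (P $ 1 * u $ 2 - P $ 2 * u $ 1) / (1 + (P $ 3)^2)^2 + P $ 3 * u $ 3 / (1 + (P $ 3)^2)"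
  by (simp add: horizon_form_def Let_def inner_vec_def sum_3 divide_simps)

text \<open>The coefficient of \<open>dZ\<^sup>2\<close> vanishes at the poles, where the tangent plane is horizontal and
  \<open>dX\<^sup>2 + dY\<^sup>2\<close> is already definite on it.\<close>
lemma riemannian_horizon_metric:
  assumes "\<alpha> \<noteq> 0"
  shows "riemannian_S2 (horizon_metric \<alpha>)"
  unfolding riemannian_S2_def
proof (intro conjI ballI impI)
  have "smooth_mat_on UNIV (horizon_metric \<alpha>)"
    by (auto simp: smooth_mat_on_def forall_3 horizon_metric_def Let_def intro!: smooth_intros)
  thus "\<exists>U. open U \<and> S2 \<subseteq> U \<and> smooth_mat_on U (horizon_metric \<alpha>)" by (intro exI[of _ UNIV]) auto
next
  fix P :: "real^3" and u v
  show "u \<bullet> (horizon_metric \<alpha> P *v v) = v \<bullet> (horizon_metric \<alpha> P *v u)"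
    by (simp add: horizon_metric_apply mult.commute)
next
  fix P :: "real^3" and u assume P: "P \<in> S2" and u: "u \<in> tangent_S2 P" "u \<noteq> 0"
  have z: "1 - (P $ 3)^2 \<ge> 0" using P unfolding mem_S2_iff by (smt (verit) zero_le_power2)
  have "4 * ((u $ 1)^2 + (u $ 2)^2) + (1 - (P $ 3)^2) * (u $ 3)^2 \<noteq> 0"
  proof
    assume sum: "4 * ((u $ 1)^2 + (u $ 2)^2) + (1 - (P $ 3)^2) * (u $ 3)^2 = 0"
    have "4 * ((u $ 1)^2 + (u $ 2)^2) \<ge> 0" "(1 - (P $ 3)^2) * (u $ 3)^2 \<ge> 0"
      using z by simp_all
    from add_nonneg_eq_0_iff[OF this] sum
    have "4 * ((u $ 1)^2 + (u $ 2)^2) = 0 \<and> (1 - (P $ 3)^2) * (u $ 3)^2 = 0" by blast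
    hence *: "(u $ 1)^2 + (u $ 2)^2 = 0" "(1 - (P $ 3)^2) * (u $ 3)^2 = 0"
      by (simp_all only: mult_eq_0_iff) simp
    hence u12: "u $ 1 = 0" "u $ 2 = 0" by (simp_all add: sum_power2_eq_zero_iff)
    hence "u $ 3 * P $ 3 = 0" using u(1) by (simp add: tangent_S2_def inner_vec_def sum_3)
    hence "u $ 3 = 0" using *(2) by auto
    thus False using u12 u(2) by (simp add: vec_eq_iff forall_3)
  qed
  hence "4 * ((u $ 1)^2 + (u $ 2)^2) + (1 - (P $ 3)^2) * (u $ 3)^2 > 0"
    using z by (smt (verit) mult_nonneg_nonneg zero_le_power2)
  moreover have "\<alpha>^2 / (1 + (P $ 3)^2) > 0" using assms one_plus_sq_pos[of "P $ 3"] by simp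
  ultimately show "u \<bullet> (horizon_metric \<alpha> P *v u) > 0"
    unfolding horizon_metric_apply power2_eq_square[of "u $ _", symmetric] by (intro mult_pos_pos)
qed

lemma smooth_horizon_form: "smooth_form_S2 horizon_form"
proof -
  have "smooth_vec_on UNIV horizon_form"
    by (auto simp: smooth_vec_on_def forall_3 horizon_form_def Let_def intro!: smooth_intros)
  thus ?thesis unfolding smooth_form_S2_def by (intro exI[of _ UNIV]) auto
qed

lemma rotation_invariant_horizon: "rotation_invariant_S2 (horizon_metric \<alpha>) horizon_form"
proof -
  have 1: "(cos t * a - sin t * b) * (sin t * c + cos t * d) - (sin t * a + cos t * b) * (cos t * c - sin t * d)
      = a * d - b * c" for a b c d t :: real
    using sin_cos_squared_add[of t] by algebra
  have 2: "(cos t * a - sin t * b) * (cos t * c - sin t * d) + (sin t * a + cos t * b) * (sin t * c + cos t * d)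
      = a * c + b * d" for a b c d t :: real
    using sin_cos_squared_add[of t] by algebra
  show ?thesis
    unfolding rotation_invariant_S2_def horizon_metric_apply horizon_form_apply rot_mult_nth 1 2
    by simp
qed

subsection \<open>Away from the poles\<close>

lemma xz_domain_pos: "p \<in> xz_domain \<Longrightarrow> 1 - (p $ 2)^2 > 0"
  using sq_less_1_iff[of "p $ 2"] by (simp add: xz_domain_def)

lemma jac_sphere_param:
  assumes "p \<in> xz_domain" "\<alpha> \<noteq> 0"
  defines "s \<equiv> sqrt (1 - (p $ 2)^2)" and "\<phi> \<equiv> p $ 1 / (2 * \<alpha>)"
  shows "jac (sphere_param \<alpha>) p 1 = vector [- s * sin \<phi> / (2 * \<alpha>), s * cos \<phi> / (2 * \<alpha>), 0]"
    "jac (sphere_param \<alpha>) p 2 = vector [- (p $ 2) / s * cos \<phi>, - (p $ 2) / s * sin \<phi>, 1]"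
proof -
  have s: "1 - (p $ 2)^2 > 0" using xz_domain_pos[OF assms(1)] .
  have 1: "pd 1 (\<lambda>q. sqrt (1 - (q $ 2)^2) * cos (q $ 1 / (2 * \<alpha>))) p = - s * sin \<phi> / (2 * \<alpha>)"
    "pd 1 (\<lambda>q. sqrt (1 - (q $ 2)^2) * sin (q $ 1 / (2 * \<alpha>))) p = s * cos \<phi> / (2 * \<alpha>)"
    by (rule pd_eqI; use assms(2) in \<open>auto intro!: derivative_eq_intros simp: s_def \<phi>_def axis_def\<close>)+
  have 2: "pd 2 (\<lambda>q. sqrt (1 - (q $ 2)^2) * cos (q $ 1 / (2 * \<alpha>))) p = - (p $ 2) / s * cos \<phi>"
    "pd 2 (\<lambda>q. sqrt (1 - (q $ 2)^2) * sin (q $ 1 / (2 * \<alpha>))) p = - (p $ 2) / s * sin \<phi>"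
    by (rule pd_eqI; use s in \<open>auto intro!: derivative_eq_intros simp: s_def \<phi>_def axis_def field_simps\<close>)+
  show "jac (sphere_param \<alpha>) p 1 = vector [- s * sin \<phi> / (2 * \<alpha>), s * cos \<phi> / (2 * \<alpha>), 0]"
    "jac (sphere_param \<alpha>) p 2 = vector [- (p $ 2) / s * cos \<phi>, - (p $ 2) / s * sin \<phi>, 1]"
    unfolding vec_eq_iff forall_3 jac_def by (simp_all add: 1 2 pd_component)
qed

lemma pull_sphere_param:
  assumes p: "p \<in> xz_domain" and \<alpha>: "\<alpha> \<noteq> 0"
  shows "pull_metric (sphere_param \<alpha>) (horizon_metric \<alpha>) p = g_fam \<alpha> p"
    and "pull_form (sphere_param \<alpha>) horizon_form p = X_fam \<alpha> p"
proof -
  define z where "z = p $ 2"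
  define s where "s = sqrt (1 - z^2)"
  define S where "S = sin (p $ 1 / (2 * \<alpha>))"
  define C where "C = cos (p $ 1 / (2 * \<alpha>))"
  have "1 - z^2 > 0" using xz_domain_pos[OF p] by (simp add: z_def)
  hence s: "s \<noteq> 0" "s^2 = 1 - z^2" by (simp_all add: s_def)
  have SC: "S^2 + C^2 = 1" by (simp add: S_def C_def)
  note J = jac_sphere_param[OF p \<alpha>, folded z_def, folded s_def S_def C_def]
  have n: "sphere_param \<alpha> p $ 1 = s * C" "sphere_param \<alpha> p $ 2 = s * S" "sphere_param \<alpha> p $ 3 = z"
    by (simp_all add: z_def s_def S_def C_def)
  have z1: "z^2 \<noteq> 1" using s by auto
  show "pull_metric (sphere_param \<alpha>) (horizon_metric \<alpha>) p = g_fam \<alpha> p"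
    unfolding vec_eq_iff forall_2 pull_metric_def vec_lambda_beta horizon_metric_apply g_fam_nth J n vector_3 z_def[symmetric]
    using s \<alpha> z1
    apply (intro conjI)
    apply (simp_all add: divide_simps)
    apply (use s(2) SC in algebra)+
    done
  show "pull_form (sphere_param \<alpha>) horizon_form p = X_fam \<alpha> p"
    unfolding vec_eq_iff forall_2 pull_form_def vec_lambda_beta horizon_form_apply X_fam_nth J n vector_3 z_def[symmetric]
    using s \<alpha> z1
    apply (intro conjI)
    apply (simp_all add: divide_simps)
    apply (use s(2) SC in algebra)+
    done
qed

text \<open>A strip of \<open>x\<close>-width \<open>4 \<bar>\<alpha>\<bar> \<pi>\<close>, one full period, is the widest on which the
  parametrisation is injective.\<close>
lemma local_param_sphere_param:
  assumes \<alpha>: "\<alpha> \<noteq> 0"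
  defines "U \<equiv> \<lambda>x. {p::real^2. \<bar>p $ 1 - x\<bar> < 2 * \<bar>\<alpha>\<bar> * pi} \<inter> xz_domain"
  shows "local_param_S2 (U x) (sphere_param \<alpha>)"
  unfolding local_param_S2_def
proof (intro conjI ballI allI impI)
  have "open {p::real^2. \<bar>p $ 1 - x\<bar> < 2 * \<bar>\<alpha>\<bar> * pi}"
    by (intro open_Collect_less continuous_intros)
  thus U: "open (U x)" unfolding U_def by (intro open_Int open_xz_domain)
  have z: "\<bar>p $ 2\<bar> < 1" if "p \<in> U x" for p using that by (auto simp: U_def xz_domain_def)
  show "smooth_vec_on (U x) (sphere_param \<alpha>)"
    unfolding smooth_vec_on_def forall_3 sphere_param_nth
    using \<alpha> xz_domain_pos by (intro conjI smooth_intros U) (auto simp: U_def)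
  show "sphere_param \<alpha> ` U x \<subseteq> S2"
    using z sphere_param_in_S2 less_imp_le by blast
  show "inj_on (sphere_param \<alpha>) (U x)"
  proof
    fix p q assume p: "p \<in> U x" and q: "q \<in> U x" and "sphere_param \<alpha> p = sphere_param \<alpha> q"
    then obtain n :: int where eq: "p $ 2 = q $ 2" and n: "p $ 1 = q $ 1 + 4 * \<alpha> * pi * n"
      using sphere_param_eq_iff[OF z[OF p] \<alpha>] by blast
    have "\<bar>4 * \<alpha> * pi * n\<bar> < 4 * \<bar>\<alpha>\<bar> * pi"
      using p q n by (auto simp: U_def)
    hence "(4 * \<bar>\<alpha>\<bar> * pi) * \<bar>real_of_int n\<bar> < (4 * \<bar>\<alpha>\<bar> * pi) * 1" by (simp add: abs_mult)
    hence "\<bar>real_of_int n\<bar> < 1" using \<alpha> by (simp add: mult_less_cancel_left)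
    hence "n = 0" by linarith
    thus "p = q" using eq n by (simp add: vec_eq_iff forall_2)
  qed
  fix p and c :: "real^2" assume p: "p \<in> U x" and c: "(\<Sum>i\<in>UNIV. c $ i *\<^sub>R jac (sphere_param \<alpha>) p i) = 0"
  have pd: "p \<in> xz_domain" using p by (simp add: U_def)
  define s where "s = sqrt (1 - (p $ 2)^2)"
  define \<phi> where "\<phi> = p $ 1 / (2 * \<alpha>)"
  have s: "s > 0" using xz_domain_pos[OF pd] by (simp add: s_def)
  note J = jac_sphere_param[OF pd \<alpha>, folded s_def \<phi>_def]
  have c2: "c $ 2 = 0" using arg_cong[OF c, of "\<lambda>v. v $ 3"] by (simp add: sum_2 J)
  have "c $ 1 * sin \<phi> = 0" "c $ 1 * cos \<phi> = 0"
    using arg_cong[OF c, of "\<lambda>v. v $ 1"] arg_cong[OF c, of "\<lambda>v. v $ 2"] s \<alpha> by (simp_all add: sum_2 J c2)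
  hence "c $ 1 = 0" using sin_zero_iff by (metis mult_eq_0_iff sin_zero_norm_cos_one norm_zero zero_neq_one)
  thus "c = 0" using c2 by (simp add: vec_eq_iff forall_2)
qed

subsection \<open>At the poles\<close>

lemma smooth_on_imp_differentiable:
  "smooth_on S f \<Longrightarrow> open S \<Longrightarrow> p \<in> S \<Longrightarrow> f differentiable (at p)"
  by (metis Ck_on.simps(2) differentiable_on_openD smooth_on_def)

definition sqnorm :: "real^2 \<Rightarrow> real" where "sqnorm q = (q $ 1)^2 + (q $ 2)^2"

definition unit_disc :: "(real^2) set" where "unit_disc = {q. sqnorm q < 1}"

text \<open>The inverse of the orthogonal projection of a hemisphere to the equatorial plane, where
  \<open>\<epsilon> = 1\<close> gives the northern and \<open>\<epsilon> = -1\<close> the southern hemisphere.\<close>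
definition pole_chart :: "real \<Rightarrow> real^2 \<Rightarrow> real^3"
  where "pole_chart \<epsilon> q = vector [q $ 1, q $ 2, \<epsilon> * sqrt (1 - sqnorm q)]"

definition pole_metric :: "real \<Rightarrow> 2 metric_field"
  where "pole_metric \<alpha> q = (\<chi> i j. \<alpha>^2 * (4 / (2 - sqnorm q) * (if i = j then 1 else 0)
    + sqnorm q / ((1 - sqnorm q) * (2 - sqnorm q)) * (q $ i * q $ j)))"

definition pole_form :: "2 vec_field"
  where "pole_form q = vector [- 2 * q $ 2 / (2 - sqnorm q)^2 - q $ 1 / (2 - sqnorm q),
                               2 * q $ 1 / (2 - sqnorm q)^2 - q $ 2 / (2 - sqnorm q)]"

lemma smooth_on_sqnorm [smooth_intros]: "open S \<Longrightarrow> smooth_on S sqnorm"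
  unfolding sqnorm_def[abs_def] by (intro smooth_intros)

lemma open_unit_disc: "open unit_disc"
  unfolding unit_disc_def sqnorm_def by (intro open_Collect_less continuous_intros)

lemma pd_sqnorm: "pd l sqnorm q = 2 * q $ l"
  using exhaust_2[of l]
  by (intro pd_eqI) (auto simp: sqnorm_def axis_def intro!: derivative_eq_intros)

lemma sqnorm_nonneg: "sqnorm q \<ge> 0"
  by (simp add: sqnorm_def)

lemma jac_pole_chart:
  assumes "q \<in> unit_disc"
  shows "jac (pole_chart \<epsilon>) q 1 = vector [1, 0, - \<epsilon> * q $ 1 / sqrt (1 - sqnorm q)]"
    "jac (pole_chart \<epsilon>) q 2 = vector [0, 1, - \<epsilon> * q $ 2 / sqrt (1 - sqnorm q)]"
proof -
  have "sqnorm q < 1" using assms by (simp add: unit_disc_def)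
  hence "((\<lambda>x. \<epsilon> * sqrt (1 - x)) has_real_derivative - \<epsilon> / (2 * sqrt (1 - sqnorm q))) (at (sqnorm q))"
    by (auto intro!: derivative_eq_intros simp: field_simps)
  moreover have "sqnorm differentiable (at q)"
    by (rule smooth_on_imp_differentiable[of UNIV]) (auto intro: smooth_intros)
  ultimately have "pd l (\<lambda>q. \<epsilon> * sqrt (1 - sqnorm q)) q = - \<epsilon> * q $ l / sqrt (1 - sqnorm q)" for l
    using pd_compose[of sqnorm q "\<lambda>x. \<epsilon> * sqrt (1 - x)"] by (simp add: pd_sqnorm)
  thus "jac (pole_chart \<epsilon>) q 1 = vector [1, 0, - \<epsilon> * q $ 1 / sqrt (1 - sqnorm q)]"
    "jac (pole_chart \<epsilon>) q 2 = vector [0, 1, - \<epsilon> * q $ 2 / sqrt (1 - sqnorm q)]"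
    by (simp_all add: jac_def vec_eq_iff forall_3 pole_chart_def pd_component)
qed

lemma local_param_pole_chart:
  assumes \<epsilon>: "\<epsilon>^2 = 1"
  shows "local_param_S2 unit_disc (pole_chart \<epsilon>)"
  unfolding local_param_S2_def
proof (intro conjI ballI allI impI open_unit_disc)
  show "smooth_vec_on unit_disc (pole_chart \<epsilon>)"
    unfolding smooth_vec_on_def forall_3 pole_chart_def vector_3
    by (intro conjI smooth_intros open_unit_disc) (simp add: unit_disc_def)
  show "pole_chart \<epsilon> ` unit_disc \<subseteq> S2"
    unfolding image_subset_iff mem_S2_iff
    using \<epsilon> by (simp add: pole_chart_def unit_disc_def power_mult_distrib sqnorm_def less_imp_le)
  show "inj_on (pole_chart \<epsilon>) unit_disc"
    by (rule inj_onI) (auto simp: pole_chart_def vec_eq_iff forall_2 forall_3)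
  fix q and c :: "real^2" assume q: "q \<in> unit_disc" and c: "(\<Sum>i\<in>UNIV. c $ i *\<^sub>R jac (pole_chart \<epsilon>) q i) = 0"
  show "c = 0"
    using arg_cong[OF c, of "\<lambda>v. v $ 1"] arg_cong[OF c, of "\<lambda>v. v $ 2"]
    by (simp add: sum_2 jac_pole_chart[OF q] vec_eq_iff forall_2)
qed

text \<open>The ambient tensors are invariant under \<open>Z \<mapsto> -Z\<close>, so that both poles have the same coordinate
  expression.\<close>
lemma pull_pole_chart:
  assumes q: "q \<in> unit_disc" and \<epsilon>: "\<epsilon>^2 = 1"
  shows "pull_metric (pole_chart \<epsilon>) (horizon_metric \<alpha>) q = pole_metric \<alpha> q"
    and "pull_form (pole_chart \<epsilon>) horizon_form q = pole_form q"
proof -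
  define r where "r = sqrt (1 - sqnorm q)"
  define n where "n = sqnorm q"
  have n: "n < 1" "n \<ge> 0" using q by (simp_all add: unit_disc_def n_def sqnorm_nonneg)
  hence r: "r \<noteq> 0" "r^2 = 1 - n" by (simp_all add: r_def n_def)
  have P3: "pole_chart \<epsilon> q $ 3 = \<epsilon> * r" "(\<epsilon> * r)^2 = 1 - n" "1 + (1 - n) = 2 - n" "1 - (1 - n) = n"
    using \<epsilon> r by (simp_all add: pole_chart_def r_def power_mult_distrib)
  have P12: "pole_chart \<epsilon> q $ 1 = q $ 1" "pole_chart \<epsilon> q $ 2 = q $ 2" by (simp_all add: pole_chart_def)
  have E: "(- \<epsilon> * x / r) * (- \<epsilon> * y / r) = x * y / (1 - n)" "\<epsilon> * r * (- \<epsilon> * x / r) = - x" for x y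
  proof -
    have "(- \<epsilon> * x / r) * (- \<epsilon> * y / r) = \<epsilon>^2 * (x * y) / r^2" by (simp add: power2_eq_square)
    thus "(- \<epsilon> * x / r) * (- \<epsilon> * y / r) = x * y / (1 - n)" using r \<epsilon> by simp
    have "\<epsilon> * r * (- \<epsilon> * x / r) = - (\<epsilon>^2 * x * (r / r))" by (simp add: power2_eq_square)
    thus "\<epsilon> * r * (- \<epsilon> * x / r) = - x" using r \<epsilon> by simp
  qed
  note J = jac_pole_chart[OF q, of \<epsilon>, folded r_def]
  show "pull_metric (pole_chart \<epsilon>) (horizon_metric \<alpha>) q = pole_metric \<alpha> q"
    unfolding vec_eq_iff forall_2 pull_metric_def vec_lambda_beta horizon_metric_apply pole_metric_def J P3 P12 vector_3 E n_def[symmetric]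
    using n by (simp add: divide_simps)
  show "pull_form (pole_chart \<epsilon>) horizon_form q = pole_form q"
    unfolding vec_eq_iff forall_2 pull_form_def vec_lambda_beta horizon_form_apply pole_form_def J P3 P12 vector_3 vector_2 E n_def[symmetric]
    by simp
qed

lemma pd_scaled_sum:
  assumes "F differentiable (at p)" "G differentiable (at p)" "Q differentiable (at p)"
  shows "pd l (\<lambda>q. c * (F q * d + G q * Q q)) p = c * (pd l F p * d + (G p * pd l Q p + pd l G p * Q p))"
  using assms by (simp add: pd_mult pd_add differentiable_add differentiable_mult)

lemma pd_pole_metric:
  assumes q: "q \<in> unit_disc"
  defines "s \<equiv> sqnorm q"
  shows "pd l (\<lambda>q. pole_metric \<alpha> q $ i $ j) q =
    \<alpha>^2 * (4 / (2 - s)^2 * (2 * q $ l) * (if i = j then 1 else 0)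
      + (s / ((1 - s) * (2 - s)) * ((if l = i then q $ j else 0) + (if l = j then q $ i else 0))
         + (2 - s^2) / ((1 - s) * (2 - s))^2 * (2 * q $ l) * (q $ i * q $ j)))"
proof -
  have nz: "1 - sqnorm q \<noteq> 0" "2 - sqnorm q \<noteq> 0" if "q \<in> unit_disc" for q
    using that by (auto simp: unit_disc_def)
  have nz': "1 - s \<noteq> 0" "2 - s \<noteq> 0" using nz[OF q] by (simp_all add: s_def)
  note diff = smooth_on_imp_differentiable[OF _ open_unit_disc q]
  have dA: "((\<lambda>x. 4 / (2 - x)) has_real_derivative 4 / (2 - s)^2) (at s)"
    using nz' by (auto intro!: derivative_eq_intros simp: power2_eq_square)
  have dB: "((\<lambda>x. x / ((1 - x) * (2 - x))) has_real_derivative (2 - s^2) / ((1 - s) * (2 - s))^2) (at s)"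
  proof -
    have "((\<lambda>x. x / ((1 - x) * (2 - x))) has_real_derivative
        (1 * ((1 - s) * (2 - s)) - s * ((- 1) * (2 - s) + (- 1) * (1 - s))) / ((1 - s) * (2 - s))^2) (at s)"
      using nz' by (auto intro!: derivative_eq_intros simp: power2_eq_square)
    moreover have "1 * ((1 - s) * (2 - s)) - s * ((- 1) * (2 - s) + (- 1) * (1 - s)) = 2 - s^2"
      by (simp add: algebra_simps power2_eq_square)
    ultimately show ?thesis by simp
  qed
  have sn: "sqnorm differentiable (at q)"
    by (rule diff) (intro smooth_intros open_unit_disc)
  have pA: "pd l (\<lambda>q. 4 / (2 - sqnorm q)) q = 4 / (2 - s)^2 * (2 * q $ l)"
    using pd_compose[OF sn, of "\<lambda>x. 4 / (2 - x)", folded s_def, OF dA] by (simp add: pd_sqnorm)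
  have pB: "pd l (\<lambda>q. sqnorm q / ((1 - sqnorm q) * (2 - sqnorm q))) q
      = (2 - s^2) / ((1 - s) * (2 - s))^2 * (2 * q $ l)"
    using pd_compose[OF sn, of "\<lambda>x. x / ((1 - x) * (2 - x))", folded s_def, OF dB] by (simp add: pd_sqnorm)
  have sA: "smooth_on unit_disc (\<lambda>q. 4 / (2 - sqnorm q))"
    and sB: "smooth_on unit_disc (\<lambda>q. sqnorm q / ((1 - sqnorm q) * (2 - sqnorm q)))"
    by (intro smooth_intros open_unit_disc; use nz in simp)+
  have pQ: "pd l (\<lambda>q. q $ i * q $ j) q = (if l = i then q $ j else 0) + (if l = j then q $ i else 0)"
    by (subst pd_mult) (auto intro!: diff smooth_intros open_unit_disc simp: pd_component)
  have "pd l (\<lambda>q. \<alpha>^2 * (4 / (2 - sqnorm q) * (if i = j then 1 else 0)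
    + sqnorm q / ((1 - sqnorm q) * (2 - sqnorm q)) * (q $ i * q $ j))) q
    = \<alpha>^2 * (pd l (\<lambda>q. 4 / (2 - sqnorm q)) q * (if i = j then 1 else 0)
      + (s / ((1 - s) * (2 - s)) * pd l (\<lambda>q. q $ i * q $ j) q
         + pd l (\<lambda>q. sqnorm q / ((1 - sqnorm q) * (2 - sqnorm q))) q * (q $ i * q $ j)))"
    unfolding s_def
  proof (rule pd_scaled_sum[where F = "\<lambda>q. 4 / (2 - sqnorm q)"
        and G = "\<lambda>q. sqnorm q / ((1 - sqnorm q) * (2 - sqnorm q))" and Q = "\<lambda>q. q $ i * q $ j"])
    show "(\<lambda>q. q $ i * q $ j) differentiable at q"
      by (rule diff) (intro smooth_on_mult smooth_on_component open_unit_disc)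
  qed (rule diff[OF sA] diff[OF sB])+
  thus ?thesis unfolding pole_metric_def vec_lambda_beta pA pB pQ .
qed


text \<open>Along the axis \<open>m\<close> the coordinates are \<open>t\<close> and \<open>0\<close>, so by the formula above each first derivative of the
  metric is \<open>t\<close> times a continuous function, whose value at \<open>0\<close> is the second derivative.\<close>
lemma pole_metric_hessian:
  "((\<lambda>t. pd l (\<lambda>q. pole_metric \<alpha> q $ i $ j) (t *\<^sub>R axis m 1)) has_real_derivative
    2 * \<alpha>^2 * (if l = m then 1 else 0) * (if i = j then 1 else 0)) (at 0)"
proof -
  let ?e = "\<lambda>i. if i = m then 1 else 0 :: real"
  let ?c = "\<lambda>t::real. \<alpha>^2 * (4 / (2 - t^2)^2 * (2 * ?e l) * (if i = j then 1 else 0)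
      + (t^2 / ((1 - t^2) * (2 - t^2)) * ((if l = i then ?e j else 0) + (if l = j then ?e i else 0))
         + (2 - (t^2)^2) / ((1 - t^2) * (2 - t^2))^2 * (2 * ?e l) * (t * ?e i * (t * ?e j))))"
  have s: "sqnorm (t *\<^sub>R axis m 1) = t^2" for t
    using exhaust_2[of m] by (auto simp: sqnorm_def axis_def)
  have a: "(t *\<^sub>R axis m 1) $ k = t * ?e k" for t k by (simp add: axis_def)
  have "\<forall>\<^sub>F t in nhds 0. t \<in> {-1<..<1::real}"
    by (rule eventually_nhds_in_open) auto
  hence ev: "\<forall>\<^sub>F t in nhds 0. pd l (\<lambda>q. pole_metric \<alpha> q $ i $ j) (t *\<^sub>R axis m 1) = ?c t * t"
  proof eventually_elim
    case (elim t)
    hence "t *\<^sub>R axis m 1 \<in> unit_disc" by (simp add: unit_disc_def s sq_less_1_iff)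
    thus ?case unfolding pd_pole_metric[OF \<open>_ \<in> unit_disc\<close>] s a by (simp add: algebra_simps)
  qed
  have "isCont ?c 0" by (intro continuous_intros) auto
  from DERIV_mult_vanishing[OF this refl DERIV_ident]
  have "((\<lambda>t. ?c t * t) has_real_derivative ?c 0 * 1) (at 0)" .
  hence "((\<lambda>t. pd l (\<lambda>q. pole_metric \<alpha> q $ i $ j) (t *\<^sub>R axis m 1)) has_real_derivative ?c 0 * 1) (at 0)"
    by (rule DERIV_cong_ev[OF refl ev refl, THEN iffD2])
  moreover have "?c 0 * 1 = 2 * \<alpha>^2 * (if l = m then 1 else 0) * (if i = j then 1 else 0)" by simp
  ultimately show ?thesis by (simp only:)
qed

text \<open>At the pole the metric is \<open>2 \<alpha>\<^sup>2 \<delta>\<close> and stationary, with second derivatives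
  \<open>2 \<alpha>\<^sup>2 \<delta>\<^sub>l\<^sub>m \<delta>\<^sub>i\<^sub>j\<close>. This gives the Ricci tensor \<open>-\<delta>\<close>, i.e. negative curvature. The form
  vanishes there and its symmetrised derivative is \<open>-\<delta>/2\<close>, since the rotational part
  \<open>X dY - Y dX\<close> contributes to the antisymmetric part only.\<close>
lemma vacuum_near_horizon_pole:
  assumes \<alpha>: "\<alpha> \<noteq> 0"
  shows "vacuum_near_horizon_at (pole_metric \<alpha>) pole_form 0"
proof -
  let ?d = "\<lambda>i j::2. if i = j then 1 else 0 :: real"
  have s0: "sqnorm 0 = 0" "0 \<in> unit_disc" by (simp_all add: sqnorm_def unit_disc_def)
  have s: "sqnorm (t *\<^sub>R axis m 1) = t^2" for t m
    using exhaust_2[of m] by (auto simp: sqnorm_def axis_def)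
  have g0: "pole_metric \<alpha> 0 = (\<chi> i j. 2 * \<alpha>^2 * ?d i j)"
    by (simp add: vec_eq_iff pole_metric_def s0)
  have inv: "matrix_inv (pole_metric \<alpha> 0) $ i $ j = ?d i j / (2 * \<alpha>^2)" for i j
  proof -
    have "pole_metric \<alpha> 0 ** (\<chi> i j. ?d i j / (2 * \<alpha>^2)) = mat 1"
      using \<alpha> by (simp add: g0 matrix_matrix_mult_def vec_eq_iff forall_2 sum_2 mat_def)
    thus ?thesis by (simp add: matrix_inv_eqI)
  qed
  have crit: "pd l (\<lambda>q. pole_metric \<alpha> q $ i $ j) 0 = 0" for l i j
    by (simp add: pd_pole_metric s0)
  have cont: "isCont (\<lambda>t. matrix_inv (pole_metric \<alpha> (0 + t *\<^sub>R axis m 1)) $ k $ l) 0" for m k l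
  proof (rule isCont_matrix_inv_2)
    show "isCont (\<lambda>t. pole_metric \<alpha> (0 + t *\<^sub>R axis m 1) $ i $ j) 0" for i j
      unfolding pole_metric_def vec_lambda_beta add_0 s by (auto intro!: continuous_intros)
  qed (use \<alpha> in \<open>simp add: g0\<close>)
  have hess: "((\<lambda>t. pd l (\<lambda>q. pole_metric \<alpha> q $ i $ j) (0 + t *\<^sub>R axis m 1)) has_real_derivative
      2 * \<alpha>^2 * ?d l m * ?d i j) (at 0)" for m l i j
    using pole_metric_hessian by simp
  have \<Gamma>: "christoffel (pole_metric \<alpha>) k i j 0 = 0" for k i j
    by (rule christoffel_critical[OF crit hess cont])
  have d\<Gamma>: "pd m (christoffel (pole_metric \<alpha>) k i j) 0
      = (?d i m * ?d k j + ?d j m * ?d i k - ?d k m * ?d i j) / 2" for m k i j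
    unfolding christoffel_critical(2)[OF crit hess cont] inv sum_2
    using exhaust_2[of k] \<alpha> by (auto simp: field_simps)
  have ric: "ricci (pole_metric \<alpha>) i j 0 = - ?d i j" for i j
    unfolding ricci_def d\<Gamma> \<Gamma> sum_2
    using exhaust_2[of i] exhaust_2[of j] by auto
  have X0: "pole_form 0 = 0" by (simp add: vec_eq_iff forall_2 pole_form_def)
  have dX: "pd 1 (\<lambda>q. pole_form q $ 1) 0 = - 1 / 2" "pd 2 (\<lambda>q. pole_form q $ 1) 0 = - 1 / 2"
    "pd 1 (\<lambda>q. pole_form q $ 2) 0 = 1 / 2" "pd 2 (\<lambda>q. pole_form q $ 2) 0 = - 1 / 2"
    unfolding pole_form_def sqnorm_def vector_2
    by (rule pd_eqI; simp add: axis_def; (rule derivative_eq_intros refl | simp)+)+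
  show ?thesis
    unfolding generalised_ricci_soliton_at_def forall_2 nabla_form_def \<Gamma> ric X0 dX sum_2
    by simp
qed

subsection \<open>The horizon geometry on the sphere\<close>

text \<open>Away from the poles \<^const>\<open>sphere_param\<close> is itself a chart and the equation is the one on the
  strip; each pole is the centre of its own chart.\<close>
lemma vacuum_near_horizon_sphere:
  assumes \<alpha>: "\<alpha> \<noteq> 0"
  shows "vacuum_near_horizon_S2 (horizon_metric \<alpha>) horizon_form"
  unfolding vacuum_near_horizon_S2_def
proof (intro conjI ballI riemannian_horizon_metric smooth_horizon_form \<alpha>)
  fix P :: "real^3" assume P: "P \<in> S2"
  show "\<exists>U \<psi>. local_param_S2 U \<psi> \<and> (\<exists>q\<in>U. \<psi> q = P \<and>
      vacuum_near_horizon_at (pull_metric \<psi> (horizon_metric \<alpha>)) (pull_form \<psi> horizon_form) q)"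
  proof (cases "(P $ 3)^2 = 1")
    case True
    hence "(P $ 1)^2 + (P $ 2)^2 = 0" using P unfolding mem_S2_iff by linarith
    hence P12: "P $ 1 = 0" "P $ 2 = 0" by (simp_all add: sum_power2_eq_zero_iff)
    let ?\<psi> = "pole_chart (P $ 3)"
    have 0: "0 \<in> unit_disc" by (simp add: unit_disc_def sqnorm_def)
    have "?\<psi> 0 = P" by (simp add: vec_eq_iff forall_3 pole_chart_def P12 sqnorm_def)
    moreover have "vacuum_near_horizon_at (pull_metric ?\<psi> (horizon_metric \<alpha>)) (pull_form ?\<psi> horizon_form) 0"
      using vacuum_near_horizon_pole[OF \<alpha>]
      by (rule generalised_ricci_soliton_at_cong[OF open_unit_disc 0, THEN iffD2, rotated 2])
         (rule pull_pole_chart[OF _ True]; assumption)+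
    ultimately show ?thesis using local_param_pole_chart[OF True] 0 by blast
  next
    case False
    moreover have "(P $ 3)^2 \<le> 1" using P unfolding mem_S2_iff by (smt (verit) zero_le_power2)
    ultimately have "(P $ 3)^2 < 1" by linarith
    hence z: "-1 < P $ 3" "P $ 3 < 1" by (simp_all add: sq_less_1_iff)
    obtain t where t: "P = sphere_param \<alpha> (vector [2 * \<alpha> * t, P $ 3])"
      using S2_sphere_param[OF \<alpha> P] by blast
    define q :: "real^2" where "q = vector [2 * \<alpha> * t, P $ 3]"
    define U where "U = {p::real^2. \<bar>p $ 1 - 2 * \<alpha> * t\<bar> < 2 * \<bar>\<alpha>\<bar> * pi} \<inter> xz_domain"
    have q: "q \<in> xz_domain" "q \<in> U" using z \<alpha> by (simp_all add: U_def q_def xz_domain_def)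
    have "local_param_S2 U (sphere_param \<alpha>)"
      unfolding U_def by (rule local_param_sphere_param[OF \<alpha>])
    moreover have "vacuum_near_horizon_at (g_fam \<alpha>) (X_fam \<alpha>) q"
      using vacuum_near_horizon_fam[OF \<alpha>] q by (simp add: generalised_ricci_soliton_on_def)
    hence "vacuum_near_horizon_at (pull_metric (sphere_param \<alpha>) (horizon_metric \<alpha>))
        (pull_form (sphere_param \<alpha>) horizon_form) q"
      by (rule generalised_ricci_soliton_at_cong[OF open_xz_domain q(1), THEN iffD2, rotated 2])
         (rule pull_sphere_param[OF _ \<alpha>]; assumption)+
    moreover have "sphere_param \<alpha> q = P" using t by (simp add: q_def)
    ultimately show ?thesis using q(2) by blast
  qed
qed

section \<open>The extremal Kerr horizon\<close>

lemma differentiable_sum_pd: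
  assumes "finite A" "\<And>c. c \<in> A \<Longrightarrow> f c differentiable (at p)"
  shows "(\<lambda>q. \<Sum>c\<in>A. f c q) differentiable (at p)
       \<and> pd i (\<lambda>q. \<Sum>c\<in>A. f c q) p = (\<Sum>c\<in>A. pd i (f c) p)"
  using assms by (induction A rule: finite_induct) (simp_all add: pd_add)

lemma pd_matrix_vector:
  fixes g :: "'n::finite metric_field"
  assumes "\<And>a b. (\<lambda>q. g q $ a $ b) differentiable (at p)"
  shows "pd i (\<lambda>q. (g q *v c) $ l) p = (\<Sum>b\<in>UNIV. c $ b * pd i (\<lambda>q. g q $ l $ b) p)"
proof -
  have "(\<lambda>q. (g q *v c) $ l) = (\<lambda>q. \<Sum>b\<in>UNIV. c $ b * g q $ l $ b)"
    by (rule ext) (simp add: matrix_vector_mult_def mult.commute)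
  moreover have "pd i (\<lambda>q. c $ b * g q $ l $ b) p = c $ b * pd i (\<lambda>q. g q $ l $ b) p" for b
    using pd_mult[of "\<lambda>_. c $ b" p "\<lambda>q. g q $ l $ b" i] assms by simp
  ultimately show ?thesis
    using differentiable_sum_pd[of UNIV "\<lambda>b q. c $ b * g q $ l $ b" p i] assms
    by (simp add: differentiable_mult)
qed

lemma matrix_inv_left:
  fixes A :: "real^'n^'n"
  assumes "invertible A"
  shows "matrix_inv A ** A = mat 1"
proof -
  obtain B where "A ** B = mat 1" "B ** A = mat 1" using assms unfolding invertible_def by blast
  thus ?thesis using matrix_inv_eqI by metis
qed

text \<open>For a Killing field with lowered form \<open>k\<close> one has
  \<open>\<nabla>\<^sub>a K\<^sub>l = (\<partial>\<^sub>a k\<^sub>l - \<partial>\<^sub>l k\<^sub>a) / 2\<close>. The condition \<open>\<nabla>\<^sub>u K = w K\<close> thus only involves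
  the first derivatives of \<open>k\<close>, and neither the Christoffel symbols nor the inverse metric have to be
  computed. When \<open>K\<close> has constant components, the Killing equation says that \<open>g\<close> is constant
  along \<open>K\<close>.\<close>
lemma cov_deriv_constant_killing:
  fixes g :: "'n::finite metric_field" and K :: "real^'n"
  defines "k \<equiv> \<lambda>l q. (g q *v K) $ l"
  assumes diff: "\<And>a b. (\<lambda>q. g q $ a $ b) differentiable (at p)"
    and inv: "invertible (g p)"
    and kill: "\<And>a b. (\<Sum>c\<in>UNIV. K $ c * pd c (\<lambda>q. g q $ a $ b) p) = 0"
    and dk: "\<And>l. (\<Sum>a\<in>UNIV. u $ a * (pd a (k l) p - pd l (k a) p)) = 2 * w * k l p"
  shows "cov_deriv g (\<lambda>_. K) u p = w *\<^sub>R K"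
proof -
  have *: "nabla_vec g (\<lambda>_. K) a b p =
      (\<Sum>l\<in>UNIV. matrix_inv (g p) $ b $ l * (pd a (k l) p - pd l (k a) p)) / 2" for a b
  proof -
    have "(\<Sum>c\<in>UNIV. christoffel g b a c p * K $ c) =
      (\<Sum>c\<in>UNIV. \<Sum>l\<in>UNIV. matrix_inv (g p) $ b $ l *
        (K $ c * pd a (\<lambda>q. g q $ l $ c) p + K $ c * pd c (\<lambda>q. g q $ a $ l) p
          - K $ c * pd l (\<lambda>q. g q $ a $ c) p)) / 2"
      unfolding christoffel_def sum_divide_distrib sum_distrib_right
      by (intro sum.cong refl) (simp add: algebra_simps)
    also have "\<dots> = (\<Sum>l\<in>UNIV. \<Sum>c\<in>UNIV. matrix_inv (g p) $ b $ l *
        (K $ c * pd a (\<lambda>q. g q $ l $ c) p + K $ c * pd c (\<lambda>q. g q $ a $ l) p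
          - K $ c * pd l (\<lambda>q. g q $ a $ c) p)) / 2"
      by (subst sum.swap) simp
    also have "\<dots> = (\<Sum>l\<in>UNIV. matrix_inv (g p) $ b $ l * (pd a (k l) p + 0 - pd l (k a) p)) / 2"
      unfolding k_def pd_matrix_vector[OF diff] sum_distrib_left[symmetric] sum_subtractf sum.distrib
      by (simp only: kill)
    finally show ?thesis by (simp add: nabla_vec_def)
  qed
  have "cov_deriv g (\<lambda>_. K) u p $ b = w * K $ b" for b
  proof -
    have "cov_deriv g (\<lambda>_. K) u p $ b = (\<Sum>a\<in>UNIV. \<Sum>l\<in>UNIV.
        matrix_inv (g p) $ b $ l * (u $ a * (pd a (k l) p - pd l (k a) p))) / 2"
      unfolding cov_deriv_def * sum_divide_distrib
      by (simp add: sum_distrib_left sum_divide_distrib algebra_simps)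
    also have "\<dots> = (\<Sum>l\<in>UNIV. matrix_inv (g p) $ b $ l *
        (\<Sum>a\<in>UNIV. u $ a * (pd a (k l) p - pd l (k a) p))) / 2"
      by (subst sum.swap) (simp add: sum_distrib_left)
    also have "\<dots> = w * (matrix_inv (g p) *v (g p *v K)) $ b"
      unfolding dk by (simp add: k_def matrix_vector_mult_def[of "matrix_inv _"] sum_distrib_left
          sum_divide_distrib mult_ac)
    also have "\<dots> = w * K $ b"
      by (simp add: matrix_vector_mul_assoc matrix_inv_left[OF inv])
    finally show ?thesis .
  qed
  thus ?thesis by (simp add: vec_eq_iff)
qed

text \<open>On this region \<open>\<Sigma> \<ge> r\<^sup>2 > 0\<close>, and the rotation axis, where the angular coordinates
  degenerate, is excluded. The mass may be negative, and with it the horizon radius \<open>r = M\<close>.\<close>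
definition kerr_region :: "(real^4) set"
  where "kerr_region = {p. p $ 2 \<noteq> 0 \<and> 0 < p $ 3 \<and> p $ 3 < pi}"

lemma open_kerr_region: "open kerr_region"
proof -
  have "kerr_region = (\<lambda>p. p $ 2) -` (-{0}) \<inter> (\<lambda>p. p $ 3) -` {0<..<pi}"
    by (auto simp: kerr_region_def)
  moreover have "open ..."
    by (intro open_Int open_vimage open_greaterThanLessThan continuous_intros open_Compl closed_singleton)
  ultimately show ?thesis by simp
qed

lemma kerr_metric_nth:
  fixes p :: "real^4" and M a :: real
  defines "S \<equiv> (p $ 2)^2 + a^2 * (cos (p $ 3))^2"
  shows "kerr_metric M a p $ 1 $ 1 = - (1 - 2 * M * p $ 2 / S)" "kerr_metric M a p $ 1 $ 2 = 1"
    "kerr_metric M a p $ 1 $ 3 = 0" "kerr_metric M a p $ 1 $ 4 = - (2 * M * a * p $ 2 * (sin (p $ 3))^2 / S)"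
    "kerr_metric M a p $ 2 $ 1 = 1" "kerr_metric M a p $ 2 $ 2 = 0"
    "kerr_metric M a p $ 2 $ 3 = 0" "kerr_metric M a p $ 2 $ 4 = - (a * (sin (p $ 3))^2)"
    "kerr_metric M a p $ 3 $ 1 = 0" "kerr_metric M a p $ 3 $ 2 = 0"
    "kerr_metric M a p $ 3 $ 3 = S" "kerr_metric M a p $ 3 $ 4 = 0"
    "kerr_metric M a p $ 4 $ 1 = - (2 * M * a * p $ 2 * (sin (p $ 3))^2 / S)"
    "kerr_metric M a p $ 4 $ 2 = - (a * (sin (p $ 3))^2)"
    "kerr_metric M a p $ 4 $ 3 = 0" "kerr_metric M a p $ 4 $ 4 =
      (((p $ 2)^2 + a^2)^2 - ((p $ 2)^2 - 2 * M * p $ 2 + a^2) * a^2 * (sin (p $ 3))^2) * (sin (p $ 3))^2 / S"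
  by (simp_all add: kerr_metric_def Let_def S_def)

lemma kerr_sigma_pos: "p \<in> kerr_region \<Longrightarrow> (p $ 2)^2 + a^2 * (cos (p $ 3))^2 > 0"
  by (simp add: kerr_region_def add_pos_nonneg)

lemma kerr_metric_symmetry:
  "c = 1 \<or> c = 4 \<Longrightarrow> kerr_metric M a (p + t *\<^sub>R axis c 1) = kerr_metric M a p"
  by (auto simp: kerr_metric_def axis_def)

lemma pd_kerr_metric_symmetry:
  "c = 1 \<or> c = 4 \<Longrightarrow> pd c (\<lambda>q. kerr_metric M a q $ i $ j) p = 0"
  by (simp add: pd_def kerr_metric_symmetry)

lemma pseudo_riemannian_kerr: "pseudo_riemannian_on kerr_region (kerr_metric M a)"
  unfolding pseudo_riemannian_on_def
proof (intro conjI ballI)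
  note kerr_sigma_pos[THEN less_imp_neq, THEN not_sym, simp]
  show "smooth_mat_on kerr_region (kerr_metric M a)"
    unfolding smooth_mat_on_def forall_4 kerr_metric_nth
    by (intro conjI smooth_intros open_kerr_region) simp_all
next
  fix p assume p: "p \<in> kerr_region"
  show "transpose (kerr_metric M a p) = kerr_metric M a p"
    by (simp add: transpose_def vec_eq_iff forall_4 kerr_metric_nth)
  define r s c where "r = p $ 2" and "s = sin (p $ 3)" and "c = cos (p $ 3)"
  define S where "S = r^2 + a^2 * c^2"
  have nz: "S \<noteq> 0" "s \<noteq> 0"
    using kerr_sigma_pos[OF p, of a] p sin_gt_zero[of "p $ 3"]
    by (auto simp: S_def r_def s_def c_def kerr_region_def)
  have "c^2 = 1 - s^2" by (simp add: s_def c_def cos_squared_eq)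
  hence S: "S = r * r + a * a - a * a * s * s"
    unfolding S_def by algebra
  \<comment> \<open>The inverse of the Kerr metric in ingoing coordinates.\<close>
  define B :: "real^4^4" where "B = vector
    [vector [a^2 * s^2 / S, (r^2 + a^2) / S, 0, a / S],
     vector [(r^2 + a^2) / S, (r^2 - 2 * M * r + a^2) / S, 0, a / S],
     vector [0, 0, 1 / S, 0],
     vector [a / S, a / S, 0, 1 / (S * s^2)]]"
  have "kerr_metric M a p ** B = mat 1"
    unfolding vec_eq_iff matrix_matrix_mult_def mat_def forall_4
    apply (simp add: sum_4 kerr_metric_nth B_def r_def[symmetric] s_def[symmetric] c_def[symmetric] S_def[symmetric])
    using nz apply (simp add: divide_simps)
    apply (simp add: S algebra_simps power2_eq_square)
    done
  thus "invertible (kerr_metric M a p)"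
    unfolding invertible_right_inverse by blast
qed


text \<open>The form \<open>k\<close> is the lowered horizon generator near a point \<open>p\<close> of the extremal horizon. The
  angular velocity is \<open>\<Omega> = a / (2 M\<^sup>2)\<close>, so \<open>a \<Omega> = 1/2\<close>.\<close>
context
  fixes M a :: real and p K :: "real^4" and k :: "4 \<Rightarrow> real^4 \<Rightarrow> real"
  assumes M: "M \<noteq> 0" and a: "a^2 = M^2" and p: "p \<in> kerr_region" and horizon: "p $ 2 = M"
    and K: "K = vector [1, 0, 0, a / (M^2 + a^2)]"
    and k_def: "k = (\<lambda>l q. (kerr_metric M a q *v K) $ l)"
begin

lemma kerr_sigma_horizon:
  "(p $ 2)^2 + a^2 * (cos (p $ 3))^2 = M^2 * (2 - (sin (p $ 3))^2)" "2 - (sin (p $ 3))^2 \<noteq> 0"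
proof -
  show *: "(p $ 2)^2 + a^2 * (cos (p $ 3))^2 = M^2 * (2 - (sin (p $ 3))^2)"
    by (simp add: horizon a cos_squared_eq algebra_simps)
  show "2 - (sin (p $ 3))^2 \<noteq> 0"
    using kerr_sigma_pos[OF p, of a] unfolding * by auto
qed

lemma generator_form:
  "k 1 q = - (1 - 2 * M * q $ 2 / ((q $ 2)^2 + a^2 * (cos (q $ 3))^2))
     - (M * q $ 2 * (sin (q $ 3))^2 / ((q $ 2)^2 + a^2 * (cos (q $ 3))^2))"
  "k 2 q = 1 - (sin (q $ 3))^2 / 2"
  "k 3 q = 0"
  "k 4 q = (- 2 * M * a * q $ 2 + a / (2 * M^2) * (((q $ 2)^2 + a^2)^2
      - ((q $ 2)^2 - 2 * M * q $ 2 + a^2) * a^2 * (sin (q $ 3))^2)) * (sin (q $ 3))^2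
      / ((q $ 2)^2 + a^2 * (cos (q $ 3))^2)"
proof -
  have O: "K $ 1 = 1" "K $ 2 = 0" "K $ 3 = 0" "K $ 4 = a / (2 * M^2)" "a * a = M * M"
    using a by (simp_all add: K power2_eq_square)
  show "k 1 q = - (1 - 2 * M * q $ 2 / ((q $ 2)^2 + a^2 * (cos (q $ 3))^2))
     - (M * q $ 2 * (sin (q $ 3))^2 / ((q $ 2)^2 + a^2 * (cos (q $ 3))^2))"
  proof -
    have "a * (r * (s * (a * t))) = M * (M * (r * (s * t)))" for r s t
      using O(5) by algebra
    thus ?thesis
      unfolding k_def matrix_vector_mult_def using M
      by (simp add: sum_4 kerr_metric_nth O power2_eq_square field_simps)
  qed
  show "k 2 q = 1 - (sin (q $ 3))^2 / 2"
  proof -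
    have "a * (s * a) = M * (M * s)" for s
      using O(5) by algebra
    thus ?thesis
      unfolding k_def matrix_vector_mult_def using M
      by (simp add: sum_4 kerr_metric_nth O power2_eq_square divide_simps)
         (simp add: algebra_simps, simp add: O(5))
  qed
  show "k 3 q = 0"
    unfolding k_def matrix_vector_mult_def by (simp add: sum_4 kerr_metric_nth O)
  show "k 4 q = (- 2 * M * a * q $ 2 + a / (2 * M^2) * (((q $ 2)^2 + a^2)^2
      - ((q $ 2)^2 - 2 * M * q $ 2 + a^2) * a^2 * (sin (q $ 3))^2)) * (sin (q $ 3))^2
      / ((q $ 2)^2 + a^2 * (cos (q $ 3))^2)"
  proof -
    define S where "S = (q $ 2)^2 + a^2 * (cos (q $ 3))^2"
    define Y where "Y = ((q $ 2)^2 + a^2)^2 - ((q $ 2)^2 - 2 * M * q $ 2 + a^2) * a^2 * (sin (q $ 3))^2"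
    show ?thesis
      unfolding k_def matrix_vector_mult_def sum_4 kerr_metric_nth O vec_lambda_beta S_def[symmetric] Y_def[symmetric]
      by (simp add: algebra_simps diff_divide_distrib)
  qed
qed

text \<open>With \<open>k\<^sub>3 = 0\<close> this says that \<open>k\<close> is a multiple of \<open>dr\<close> along the horizon \<open>r = M\<close>, so the
  generator is null on it and orthogonal to it.\<close>
lemma generator_form_horizon:
  assumes "q $ 2 = M"
  shows "k 1 q = 0" "k 4 q = 0"
proof -
  show "k 1 q = 0"
  proof -
    have "M^2 + M^2 * (cos (q $ 3))^2 \<noteq> 0"
      using M by (simp add: add_pos_nonneg less_imp_neq[THEN not_sym])
    moreover have "(sin (q $ 3))^2 = 1 - (cos (q $ 3))^2" by (rule sin_squared_eq)
    ultimately show ?thesis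
      unfolding generator_form using assms a
      by (simp add: divide_simps) (simp add: algebra_simps power2_eq_square)
  qed
  show "k 4 q = 0"
    unfolding generator_form using assms M a
    by (simp add: power2_eq_square)
qed


lemma pd_generator_form_symmetry:
  "c = 1 \<or> c = 4 \<Longrightarrow> pd c (k l) p = 0"
  by (simp add: pd_def k_def kerr_metric_symmetry)

lemma pd_generator_form_polar:
  "pd 3 (k 1) p = 0" "pd 3 (k 2) p = - sin (p $ 3) * cos (p $ 3)" "pd 3 (k 3) p = 0" "pd 3 (k 4) p = 0"
proof -
  have "pd 3 (\<lambda>q. 1 - (sin (q $ 3))^2 / 2) p = - sin (p $ 3) * cos (p $ 3)"
    by (subst pd_fun_component[where F = "\<lambda>\<theta>. 1 - (sin \<theta>)^2 / 2"])
       (auto intro!: derivative_eq_intros)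
  thus "pd 3 (k 2) p = - sin (p $ 3) * cos (p $ 3)"
    unfolding generator_form[abs_def] .
  show "pd 3 (k 3) p = 0"
    unfolding generator_form[abs_def] by simp
  \<comment> \<open>The line through \<open>p\<close> in the polar direction stays in the horizon.\<close>
  have *: "k 1 (p + t *\<^sub>R axis 3 1) = 0" "k 4 (p + t *\<^sub>R axis 3 1) = 0" for t
    by (rule generator_form_horizon; simp add: axis_def horizon)+
  show "pd 3 (k 1) p = 0" "pd 3 (k 4) p = 0"
    by (simp_all add: pd_def *)
qed

lemma pd_generator_form_radial:
  "pd 2 (k 1) p = - ((sin (p $ 3))^2) / (M * (2 - (sin (p $ 3))^2))"
  "pd 2 (k 2) p = 0" "pd 2 (k 3) p = 0"
  "pd 2 (k 4) p = 2 * a * (sin (p $ 3))^2 / (M * (2 - (sin (p $ 3))^2))"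
proof -
  have "pd 2 (\<lambda>q. 1 - (sin (q $ 3))^2 / 2) p = 0"
    by (subst pd_fun_component[where F = "\<lambda>\<theta>. 1 - (sin \<theta>)^2 / 2"])
       (auto intro!: derivative_eq_intros)
  thus "pd 2 (k 2) p = 0"
    unfolding generator_form[abs_def] .
  show "pd 2 (k 3) p = 0"
    unfolding generator_form[abs_def] by simp
  define s where "s = (sin (p $ 3))^2"
  have c: "(cos (p $ 3))^2 = 1 - s" by (simp add: s_def cos_squared_eq)
  have S: "M^2 + M^2 * (1 - s) \<noteq> 0" and s2: "2 - s \<noteq> 0"
    using kerr_sigma_pos[OF p, of a] kerr_sigma_horizon M by (simp_all add: c horizon a s_def)
  show "pd 2 (k 1) p = - ((sin (p $ 3))^2) / (M * (2 - (sin (p $ 3))^2))"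
    unfolding generator_form[abs_def]
    apply (rule pd_eqI)
    apply (simp add: axis_def horizon s_def[symmetric] c a)
    apply (rule derivative_eq_intros refl | use S in simp; fail)+
    using S s2 M apply (simp add: divide_simps)
    apply (simp add: algebra_simps power2_eq_square)
    done
  show "pd 2 (k 4) p = 2 * a * (sin (p $ 3))^2 / (M * (2 - (sin (p $ 3))^2))"
    unfolding generator_form[abs_def]
    apply (rule pd_eqI)
    apply (simp add: axis_def horizon s_def[symmetric] c a)
    apply (rule derivative_eq_intros refl | use S M in simp; fail)+
    using S s2 M apply (simp add: divide_simps)
    apply (simp add: algebra_simps power2_eq_square power4_eq_xxxx)
    done
qed


text \<open>For \<open>u\<close> tangent to the horizon only \<open>\<partial>\<^sub>\<theta> k\<^sub>r\<close>, \<open>\<partial>\<^sub>r k\<^sub>v\<close> and \<open>\<partial>\<^sub>r k\<^sub>\<phi>\<close>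
  contribute. For \<open>u = K\<close> the last two cancel, which is the vanishing of the surface gravity.\<close>
lemma cov_deriv_generator:
  fixes u :: "real^4"
  assumes "u $ 2 = 0"
    and w: "w = - (u $ 3 * sin (p $ 3) * cos (p $ 3)) / (2 - (sin (p $ 3))^2)
      + (u $ 1 - 2 * a * u $ 4) * (sin (p $ 3))^2 / (M * (2 - (sin (p $ 3))^2)^2)"
  shows "cov_deriv (kerr_metric M a) (\<lambda>_. K) u p = w *\<^sub>R K"
proof (rule cov_deriv_constant_killing)
  have smooth: "smooth_on kerr_region (\<lambda>q. kerr_metric M a q $ i $ j)" for i j
    using pseudo_riemannian_kerr by (simp add: pseudo_riemannian_on_def smooth_mat_on_def)
  show "(\<lambda>q. kerr_metric M a q $ i $ j) differentiable (at p)" for i j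
    using smooth[of i j] p differentiable_on_openD[OF _ open_kerr_region]
    by (metis Ck_on.simps(2) smooth_on_def)
  show "invertible (kerr_metric M a p)"
    using pseudo_riemannian_kerr p by (simp add: pseudo_riemannian_on_def)
  show "(\<Sum>c\<in>UNIV. K $ c * pd c (\<lambda>q. kerr_metric M a q $ i $ j) p) = 0" for i j
    by (simp add: sum_4 K pd_kerr_metric_symmetry)
next
  fix l :: 4
  define s where "s = (sin (p $ 3))^2"
  define D where "D = 2 - s"
  have s2: "D \<noteq> 0" using kerr_sigma_horizon by (simp add: s_def D_def)
  have kp: "k 1 p = 0" "k 2 p = D / 2" "k 3 p = 0" "k 4 p = 0"
    using horizon by (simp_all add: generator_form_horizon) (simp_all add: generator_form s_def D_def diff_divide_distrib)
  note d = pd_generator_form_polar pd_generator_form_radial pd_generator_form_symmetry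
    s_def[symmetric] D_def[symmetric]
  have "(\<Sum>b\<in>UNIV. u $ b * (pd b (k l) p - pd l (k b) p)) = 2 * w * k l p"
    using exhaust_4[of l] s2 M
    by (auto simp: sum_4 assms(1) w d kp) (simp add: field_simps power2_eq_square)
  thus "(\<Sum>b\<in>UNIV. u $ b * (pd b (\<lambda>q. (kerr_metric M a q *v K) $ l) p
      - pd l (\<lambda>q. (kerr_metric M a q *v K) $ b) p)) = 2 * w * (kerr_metric M a p *v K) $ l"
    by (simp add: k_def)
qed

end

lemma jac_polar_to_xz:
  "jac (polar_to_xz m) q 1 = vector [0, - sin (q $ 1)]" "jac (polar_to_xz m) q 2 = vector [m, 0]"
proof -
  have "pd i (\<lambda>r. polar_to_xz m r $ 1) q = (if i = 2 then m else 0)" for i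
    using pd_fun_component[where F = "\<lambda>x. m * x" and p = q and j = 2 and D = m and i = i]
    by (auto simp: polar_to_xz_def intro!: derivative_eq_intros)
  moreover have "pd i (\<lambda>r. polar_to_xz m r $ 2) q = (if i = 1 then - sin (q $ 1) else 0)" for i
    using pd_fun_component[where F = cos and p = q and j = 1 and D = "- sin (q $ 1)" and i = i]
    by (auto simp: polar_to_xz_def intro!: derivative_eq_intros)
  ultimately show "jac (polar_to_xz m) q 1 = vector [0, - sin (q $ 1)]"
    "jac (polar_to_xz m) q 2 = vector [m, 0]"
    by (simp_all add: jac_def vec_eq_iff forall_2)
qed

lemma jac_kerr_section:
  assumes "k \<noteq> 0"
  shows "jac (kerr_section M v0 k) q 1 = vector [0, 0, 1, 0]"
    "jac (kerr_section M v0 k) q 2 = vector [0, 0, 0, 1 / k]"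
proof -
  have "pd i (\<lambda>r. kerr_section M v0 k r $ 4) q = (if i = 2 then 1 / k else 0)" for i
  proof -
    have "((\<lambda>x. x / k) has_real_derivative 1 / k) (at (q $ 2))"
      using assms by (auto intro!: derivative_eq_intros)
    from pd_fun_component[OF this] show ?thesis by (simp add: kerr_section_def)
  qed
  thus "jac (kerr_section M v0 k) q 1 = vector [0, 0, 1, 0]"
    "jac (kerr_section M v0 k) q 2 = vector [0, 0, 0, 1 / k]"
    by (simp_all add: jac_def vec_eq_iff forall_4 kerr_section_def pd_component)
qed

text \<open>The usual azimuth is \<open>\<phi> / k\<close>, and \<open>m k = 2 \<alpha>\<close> makes \<open>x = m \<phi>\<close> equal to
  \<open>2 \<alpha>\<close> times it. The azimuth of period \<open>2 \<pi>\<close> is the case \<open>k = 1\<close>; for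
  \<open>k = \<alpha>\<close> the coordinate change becomes \<open>x = 2 \<phi>\<close>.\<close>
lemma extremal_kerr_horizon:
  assumes \<alpha>: "\<alpha> \<noteq> 0" and k: "k \<noteq> 0" and m: "m * k = 2 * \<alpha>"
  shows "is_extremal_kerr_horizon \<alpha> (- \<alpha>) k
    (pull_metric (polar_to_xz m) (g_fam \<alpha>)) (pull_form (polar_to_xz m) (X_fam \<alpha>))"
  unfolding is_extremal_kerr_horizon_def degenerate_killing_horizon_def
proof (intro conjI allI ballI)
  fix v0
  let ?i = "kerr_section \<alpha> v0 k" and ?G = "kerr_metric \<alpha> (- \<alpha>)"
  define K :: "real^4" where "K = vector [1, 0, 0, - \<alpha> / (\<alpha>^2 + (- \<alpha>)^2)]"
  have gen: "kerr_horizon_generator \<alpha> (- \<alpha>) = (\<lambda>_. K)"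
    by (rule ext) (simp add: kerr_horizon_generator_def K_def)
  have region: "?i q \<in> kerr_region" if "q \<in> polar_domain" for q
    using that \<alpha> by (simp add: kerr_section_def kerr_region_def polar_domain_def)
  show "\<exists>N. open N \<and> ?i ` polar_domain \<subseteq> N \<and> pseudo_riemannian_on N ?G \<and>
      smooth_vec_on N (kerr_horizon_generator \<alpha> (- \<alpha>)) \<and>
      (\<forall>p\<in>N. killing_at ?G (kerr_horizon_generator \<alpha> (- \<alpha>)) p)"
    unfolding gen
    using region
    by (intro exI[of _ kerr_region] conjI open_kerr_region pseudo_riemannian_kerr)
       (auto simp: smooth_vec_on_def smooth_on_const killing_at_def sum_4 K_def pd_kerr_metric_symmetry)
  fix q assume q: "q \<in> polar_domain"
  define S where "S = sin (q $ 1)"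
  define C where "C = cos (q $ 1)"
  have sin_pos: "S > 0" and C: "C^2 = 1 - S^2"
    using q by (auto simp: S_def C_def polar_domain_def sin_gt_zero cos_squared_eq)
  have D: "2 - S^2 > 0" using C zero_le_power2[of C] by linarith
  have i: "?i q $ 2 = \<alpha>" "?i q $ 3 = q $ 1" by (simp_all add: kerr_section_def)
  note ctx = \<alpha> power2_minus[of \<alpha>] region[OF q] i(1) K_def refl
  note cov = cov_deriv_generator[OF ctx, unfolded i, folded S_def C_def]
  have kvec: "(?G (?i q) *v K) $ 1 = 0" "(?G (?i q) *v K) $ 3 = 0" "(?G (?i q) *v K) $ 4 = 0"
    using generator_form_horizon[OF ctx i(1)] generator_form(3)[OF ctx] by simp_all
  note J = jac_kerr_section[OF k] jac_polar_to_xz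
  show "kerr_horizon_generator \<alpha> (- \<alpha>) (?i q) \<noteq> 0"
    by (simp add: gen K_def vec_eq_iff forall_4)
  show "kerr_horizon_generator \<alpha> (- \<alpha>) (?i q) \<bullet> (?G (?i q) *v kerr_horizon_generator \<alpha> (- \<alpha>) (?i q)) = 0"
    by (simp add: gen inner_vec_def sum_4 kvec) (simp add: K_def)
  show "cov_deriv ?G (kerr_horizon_generator \<alpha> (- \<alpha>)) (kerr_horizon_generator \<alpha> (- \<alpha>) (?i q)) (?i q) = 0"
    unfolding gen using cov[of K 0] \<alpha> by (simp add: K_def power2_eq_square)
  fix j :: 2
  have sym: "u \<bullet> (?G (?i q) *v v) = v \<bullet> (?G (?i q) *v u)" for u v
  proof -
    have "transpose (?G (?i q)) = ?G (?i q)"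
      using pseudo_riemannian_kerr region[OF q] by (simp add: pseudo_riemannian_on_def)
    thus ?thesis by (metis dot_lmul_matrix inner_commute vector_transpose_matrix)
  qed
  show "kerr_horizon_generator \<alpha> (- \<alpha>) (?i q) \<bullet> (?G (?i q) *v jac ?i q j) = 0"
    unfolding gen sym[of K] using exhaust_2[of j] by (auto simp: inner_vec_def sum_4 kvec J)
  show "cov_deriv ?G (kerr_horizon_generator \<alpha> (- \<alpha>)) (jac ?i q j) (?i q)
      = pull_form (polar_to_xz m) (X_fam \<alpha>) q $ j *\<^sub>R kerr_horizon_generator \<alpha> (- \<alpha>) (?i q)"
    unfolding gen
  proof (rule cov)
    show "jac ?i q j $ 2 = 0" using exhaust_2[of j] by (auto simp: J)
    have z: "polar_to_xz m q $ 2 = C" by (simp add: polar_to_xz_def C_def)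
    have m': "m = 2 * \<alpha> / k" using m k by (simp add: field_simps)
    show "pull_form (polar_to_xz m) (X_fam \<alpha>) q $ j =
      - (jac ?i q j $ 3 * S * C) / (2 - S\<^sup>2)
      + (jac ?i q j $ 1 - 2 * - \<alpha> * jac ?i q j $ 4) * S\<^sup>2 / (\<alpha> * (2 - S\<^sup>2)\<^sup>2)"
      using exhaust_2[of j] D \<alpha> k
      by (auto simp: pull_form_def J inner_vec_def sum_2 z C S_def[symmetric])
         (simp_all add: m' divide_simps)
  qed
next
  fix v0 q assume q: "q \<in> polar_domain"
  define S where "S = sin (q $ 1)"
  define C where "C = cos (q $ 1)"
  have sin_pos: "S > 0" and C: "C^2 = 1 - S^2"
    using q by (auto simp: S_def C_def polar_domain_def sin_gt_zero cos_squared_eq)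
  have D: "2 - S^2 > 0" using C zero_le_power2[of C] by linarith
  have z: "polar_to_xz m q $ 2 = C" by (simp add: polar_to_xz_def C_def)
  have m': "m = 2 * \<alpha> / k" using m k by (simp add: field_simps)
  have i: "kerr_section \<alpha> v0 k q $ 2 = \<alpha>" "kerr_section \<alpha> v0 k q $ 3 = q $ 1"
    by (simp_all add: kerr_section_def)
  note J = jac_kerr_section[OF k] jac_polar_to_xz
  have N: "\<alpha>^2 + \<alpha>^2 * (1 - S^2) = \<alpha>^2 * (2 - S^2)" by (simp add: algebra_simps)
  show "pull_metric (kerr_section \<alpha> v0 k) (kerr_metric \<alpha> (- \<alpha>)) q = pull_metric (polar_to_xz m) (g_fam \<alpha>) q"
    using sin_pos \<alpha> k D
    apply (simp add: vec_eq_iff forall_2 pull_metric_def J inner_vec_def sum_2 sum_4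
        matrix_vector_mult_def kerr_metric_nth z i C S_def[symmetric] C_def[symmetric] N)
    apply (simp add: m' field_simps power2_eq_square power4_eq_xxxx)
    done
qed simp

theorem corollary7p19:
  fixes \<alpha> :: real
  assumes "\<alpha> \<noteq> 0"
  shows
    "vacuum_near_horizon_on xz_domain (g_fam \<alpha>) (X_fam \<alpha>)
    \<comment> \<open>extension to a smooth rotationally symmetric geometry on the 2-sphere\<close>
    \<and> (\<exists>G W. vacuum_near_horizon_S2 G W \<and> rotation_invariant_S2 G W \<and>
         (\<forall>p\<in>xz_domain. pull_metric (sphere_param \<alpha>) G p = g_fam \<alpha> p \<and>
                         pull_form (sphere_param \<alpha>) W p = X_fam \<alpha> p))
    \<comment> \<open>the sphere is the rectangle with its boundary identifications; x is azimuthal\<close>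
    \<and> continuous_on (xz_rectangle \<alpha>) (sphere_param \<alpha>)
    \<and> sphere_param \<alpha> ` xz_rectangle \<alpha> = S2
    \<and> (\<forall>p\<in>xz_rectangle \<alpha>. \<forall>q\<in>xz_rectangle \<alpha>.
         sphere_param \<alpha> p = sphere_param \<alpha> q \<longleftrightarrow> sphere_glue \<alpha> p q)
    \<and> (\<forall>x z t. -1 \<le> z \<and> z \<le> 1 \<longrightarrow>
         sphere_param \<alpha> (vector [x + t, z]) = rot (t / (2 * \<alpha>)) *v sphere_param \<alpha> (vector [x, z]))
    \<comment> \<open>extremal Kerr with M = \<alpha>: azimuth of period \<open>2\<pi>\<close>, where x = \<open>2\<alpha>\<phi>\<close>\<close>
    \<and> is_extremal_kerr_horizon \<alpha> (- \<alpha>) 1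
         (pull_metric (polar_to_xz (2 * \<alpha>)) (g_fam \<alpha>))
         (pull_form (polar_to_xz (2 * \<alpha>)) (X_fam \<alpha>))
    \<and> bij_betw (polar_to_xz (2 * \<alpha>)) (polar_rectangle 1) (xz_rectangle \<alpha>)
    \<comment> \<open>extremal Kerr with M = \<alpha>: \<open>\<phi>\<close> of period \<open>2\<pi>M\<close>, where x = \<open>2\<phi>\<close>\<close>
    \<and> is_extremal_kerr_horizon \<alpha> (- \<alpha>) \<alpha>
         (pull_metric (polar_to_xz 2) (g_fam \<alpha>))
         (pull_form (polar_to_xz 2) (X_fam \<alpha>))
    \<and> bij_betw (polar_to_xz 2) (polar_rectangle \<alpha>) (xz_rectangle \<alpha>)"
proof -
  have "\<exists>G W. vacuum_near_horizon_S2 G W \<and> rotation_invariant_S2 G W \<and>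
      (\<forall>p\<in>xz_domain. pull_metric (sphere_param \<alpha>) G p = g_fam \<alpha> p \<and>
                      pull_form (sphere_param \<alpha>) W p = X_fam \<alpha> p)"
    using vacuum_near_horizon_sphere[OF assms] rotation_invariant_horizon pull_sphere_param[OF _ assms]
    by blast
  moreover have "2 * \<alpha> * 1 = 2 * \<alpha>" by simp
  ultimately show ?thesis
    using assms vacuum_near_horizon_fam continuous_sphere_param sphere_param_image sphere_param_glue
      sphere_param_rot extremal_kerr_horizon[OF assms, of 1 "2 * \<alpha>"] extremal_kerr_horizon[OF assms, of \<alpha> 2]
      bij_betw_polar_to_xz[OF assms, of "2 * \<alpha>" 1] bij_betw_polar_to_xz[OF assms, of 2 \<alpha>]
    by (intro conjI ballI allI impI) simp_all
qed

end
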